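(* For small $\varepsilon>0$, the one-parameter family of solutions $$\psi_1(x)=\cos\theta\,\eta_\varepsilon(x),\qquad \psi_2(x)=\sin\theta\,\eta_\varepsilon(x),\qquad \theta\in[0,\tfrac{\pi}{2}],$$ which exists for $\gamma=1$, of the system $$-\varepsilon^2\psi_1''+x^2\psi_1+(\psi_1^2+\gamma\psi_2^2-1)\psi_1=0,\qquad -\varepsilon^2\psi_2''+x^2\psi_2+(\gamma\psi_1^2+\psi_2^2-1)\psi_2=0,\qquad x\in\mathbb{R},$$ is only continued for $\gamma\ne1$ either as the uncoupled states (S1), $(\psi_1,\psi_2)=(\eta_\varepsilon,0)$ and $(\psi_1,\psi_2)=(0,\eta_\varepsilon)$, or as the symmetric state (S2), $(\psi_1,\psi_2)=(1+\gamma)^{-1/2}(\eta_\varepsilon,\eta_\varepsilon)$.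
   Context: Here $\gamma>0$ is the coupling parameter, solutions $\Psi=(\psi_1,\psi_2)$ are real-valued and taken in the energy space $\mathcal{E}=H^1(\mathbb{R};\mathbb{R}^2)\cap L^{2,1}(\mathbb{R};\mathbb{R}^2)$, where $L^{2,1}(\mathbb{R})=\{f\in L^2(\mathbb{R}):|x|f\in L^2(\mathbb{R})\}$. The function $\eta_\varepsilon\in H^1(\mathbb{R};\mathbb{R})\cap L^{2,1}(\mathbb{R};\mathbb{R})$ is the positive solution of $\varepsilon^2\eta_\varepsilon''+(1-x^2-\eta_\varepsilon^2)\eta_\varepsilon=0$ on $\mathbb{R}$. The restriction $\theta\in[0,\frac{\pi}{2}]$ is required for positivity of solutions; the family is due to the additional rotational symmetry of the system at $\gamma=1$, and it contains the states (S1) for $\theta=0$ and $\theta=\frac{\pi}{2}$ and the state (S2) for $\theta=\frac{\pi}{4}$. *)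

theory Defs
  imports "HOL-Analysis.Analysis"
begin

text \<open>
  Functions on the line are represented by everywhere defined Borel functions; all integrals
  are Lebesgue integrals.
\<close>

definition square_integrable :: "(real \<Rightarrow> real) \<Rightarrow> bool" where
  "square_integrable f \<longleftrightarrow> f \<in> borel_measurable lborel \<and> integrable lborel (\<lambda>x. (f x)\<^sup>2)"

definition test_function :: "(real \<Rightarrow> real) \<Rightarrow> bool" where
  "test_function \<phi> \<longleftrightarrow> \<phi> differentiable_on UNIV \<and> continuous_on UNIV (deriv \<phi>) \<and>
     (\<exists>R. \<forall>x. \<bar>x\<bar> > R \<longrightarrow> \<phi> x = 0)"

text \<open>
  On the line it is customary (and equivalent) to test the weak derivative against compactly
  supported functions of class $C^1$ instead of $C^\infty$.
\<close>

definition has_weak_deriv :: "(real \<Rightarrow> real) \<Rightarrow> (real \<Rightarrow> real) \<Rightarrow> bool" where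
  "has_weak_deriv f g \<longleftrightarrow>
     (\<forall>\<phi>. test_function \<phi> \<longrightarrow>
        (LINT x|lborel. f x * deriv \<phi> x) = - (LINT x|lborel. g x * \<phi> x))"

definition H1 :: "(real \<Rightarrow> real) set" where
  "H1 = {f. square_integrable f \<and> (\<exists>g. square_integrable g \<and> has_weak_deriv f g)}"

definition L21 :: "(real \<Rightarrow> real) set" where
  "L21 = {f. square_integrable f \<and> square_integrable (\<lambda>x. \<bar>x\<bar> * f x)}"

text \<open>The weak derivative of an element of \<open>H1\<close> is unique only up to null sets.\<close>

definition weak_deriv :: "(real \<Rightarrow> real) \<Rightarrow> real \<Rightarrow> real" where
  "weak_deriv f = (SOME g. square_integrable g \<and> has_weak_deriv f g)"

type_synonym state = "(real \<Rightarrow> real) \<times> (real \<Rightarrow> real)"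

definition energy_space :: "state set" where
  "energy_space = (H1 \<inter> L21) \<times> (H1 \<inter> L21)"

text \<open>The norm and the distance are meaningful on \<open>energy_space\<close> only.\<close>

definition energy_norm :: "state \<Rightarrow> real" where
  "energy_norm \<Psi> = sqrt (\<Sum>f\<leftarrow>[fst \<Psi>, snd \<Psi>].
     (LINT x|lborel. (f x)\<^sup>2) + (LINT x|lborel. (weak_deriv f x)\<^sup>2) +
     (LINT x|lborel. (\<bar>x\<bar> * f x)\<^sup>2))"

definition energy_dist :: "state \<Rightarrow> state \<Rightarrow> real" where
  "energy_dist \<Psi> \<Phi> =
     energy_norm ((\<lambda>x. fst \<Psi> x - fst \<Phi> x), (\<lambda>x. snd \<Psi> x - snd \<Phi> x))"

definition twice_differentiable :: "(real \<Rightarrow> real) \<Rightarrow> bool" where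
  "twice_differentiable f \<longleftrightarrow> f differentiable_on UNIV \<and> deriv f differentiable_on UNIV"

definition positive_ground_state :: "real \<Rightarrow> (real \<Rightarrow> real) \<Rightarrow> bool" where
  "positive_ground_state \<epsilon> \<eta> \<longleftrightarrow>
     \<eta> \<in> H1 \<inter> L21 \<and> twice_differentiable \<eta> \<and> (\<forall>x. \<eta> x > 0) \<and>
     (\<forall>x. \<epsilon>\<^sup>2 * deriv (deriv \<eta>) x + (1 - x\<^sup>2 - (\<eta> x)\<^sup>2) * \<eta> x = 0)"

text \<open>
  Solutions are classical: a distributional solution in the energy space has a smooth
  representative, by elliptic regularity in one dimension.
\<close>

definition coupled_solution :: "real \<Rightarrow> real \<Rightarrow> state \<Rightarrow> bool" where
  "coupled_solution \<epsilon> \<gamma> \<Psi> \<longleftrightarrow>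
     \<Psi> \<in> energy_space \<and>
     (case \<Psi> of (\<psi>\<^sub>1, \<psi>\<^sub>2) \<Rightarrow>
        twice_differentiable \<psi>\<^sub>1 \<and> twice_differentiable \<psi>\<^sub>2 \<and>
        (\<forall>x. - (\<epsilon>\<^sup>2) * deriv (deriv \<psi>\<^sub>1) x + x\<^sup>2 * \<psi>\<^sub>1 x
             + ((\<psi>\<^sub>1 x)\<^sup>2 + \<gamma> * (\<psi>\<^sub>2 x)\<^sup>2 - 1) * \<psi>\<^sub>1 x = 0) \<and>
        (\<forall>x. - (\<epsilon>\<^sup>2) * deriv (deriv \<psi>\<^sub>2) x + x\<^sup>2 * \<psi>\<^sub>2 x
             + (\<gamma> * (\<psi>\<^sub>1 x)\<^sup>2 + (\<psi>\<^sub>2 x)\<^sup>2 - 1) * \<psi>\<^sub>2 x = 0))"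

definition rotated_state :: "(real \<Rightarrow> real) \<Rightarrow> real \<Rightarrow> state" where
  "rotated_state \<eta> \<theta> = ((\<lambda>x. cos \<theta> * \<eta> x), (\<lambda>x. sin \<theta> * \<eta> x))"

definition uncoupled_state1 :: "(real \<Rightarrow> real) \<Rightarrow> state" where
  "uncoupled_state1 \<eta> = (\<eta>, (\<lambda>x. 0))"

definition uncoupled_state2 :: "(real \<Rightarrow> real) \<Rightarrow> state" where
  "uncoupled_state2 \<eta> = ((\<lambda>x. 0), \<eta>)"

definition symmetric_state :: "(real \<Rightarrow> real) \<Rightarrow> real \<Rightarrow> state" where
  "symmetric_state \<eta> \<gamma> =
     ((\<lambda>x. (1 + \<gamma>) powr (- 1 / 2) * \<eta> x), (\<lambda>x. (1 + \<gamma>) powr (- 1 / 2) * \<eta> x))"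

text \<open>
  A branch \<open>\<Phi>\<close>, indexed by the coupling parameter, continues the state \<open>\<Psi>\<close> if it consists of
  solutions and converges to \<open>\<Psi>\<close> in the energy space as the parameter tends to 1.
\<close>

definition continues :: "real \<Rightarrow> (real \<Rightarrow> state) \<Rightarrow> state \<Rightarrow> bool" where
  "continues \<epsilon> \<Phi> \<Psi> \<longleftrightarrow>
     (\<forall>\<gamma>>0. coupled_solution \<epsilon> \<gamma> (\<Phi> \<gamma>)) \<and>
     ((\<lambda>\<gamma>. energy_dist (\<Phi> \<gamma>) \<Psi>) \<longlongrightarrow> 0) (at 1)"

end

theory Submission imports Defs begin

text \<open>
  For a solution \<open>(f, g)\<close> the Wronskian \<open>W = f g' - g f'\<close> satisfies
  \<open>\<epsilon>\<^sup>2 W' = (\<gamma> - 1) f g (f\<^sup>2 - g\<^sup>2)\<close>, and \<open>W\<close> is integrable. Suppose that \<open>\<bar>g\<bar> < f\<close> on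
  \<open>[-2, 2]\<close>; convexity outside this interval extends \<open>\<bar>g\<bar> \<le> f\<close> and \<open>0 < f\<close> to the whole line. If
  \<open>\<gamma> \<noteq> 1\<close> and \<open>g\<close> had no zero, then \<open>W\<close> would be monotone and integrable, hence zero, which is
  impossible. So the quotient \<open>q = g / f\<close> vanishes somewhere, and since \<open>f\<^sup>2 q' = W\<close> with \<open>W'\<close> of size
  \<open>\<bar>\<gamma> - 1\<bar> sup \<bar>q\<bar>\<close>, a bound \<open>\<bar>q\<bar> \<le> M\<close> improves to \<open>\<bar>q\<bar> \<le> M / 2\<close> for \<open>\<gamma>\<close> close to 1. Therefore
  \<open>g = 0\<close>, and \<open>f = \<eta>\<close> by uniqueness of the positive scalar solution.

  This covers all states near the rotated family with \<open>\<theta>\<close> away from \<open>\<pi>/4\<close>, after swapping the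
  components if necessary. Near \<open>\<pi>/4\<close> both components are positive on \<open>[-2, 2]\<close>, and the same argument
  applies to suitable multiples of \<open>f + g\<close> and \<open>f - g\<close>, which solve the system with coupling
  \<open>(3 - \<gamma>) / (1 + \<gamma>)\<close>.
\<close>

section \<open>Weak derivatives and the energy norm\<close>

lemma integrable_mult_square_integrable:
  assumes "square_integrable f" "square_integrable g"
  shows "integrable lborel (\<lambda>x. f x * g x)"
proof (rule Bochner_Integration.integrable_bound)
  have [measurable]: "f \<in> borel_measurable borel" "g \<in> borel_measurable borel"
    using assms by (auto simp: square_integrable_def)
  show "integrable lborel (\<lambda>x. (f x)\<^sup>2 + (g x)\<^sup>2)"
    using assms by (auto simp: square_integrable_def)
  show "(\<lambda>x. f x * g x) \<in> borel_measurable lborel" by measurable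
  have "\<bar>f x * g x\<bar> \<le> (f x)\<^sup>2 + (g x)\<^sup>2" for x
    using sum_squares_bound[of "\<bar>f x\<bar>" "\<bar>g x\<bar>"] by (auto simp: abs_mult intro: order_trans[rotated])
  then show "AE x in lborel. norm (f x * g x) \<le> norm ((f x)\<^sup>2 + (g x)\<^sup>2)"
    by auto
qed

lemma square_integrable_combination:
  assumes "square_integrable f" "square_integrable g"
  shows "square_integrable (\<lambda>x. a * f x + b * g x)"
proof -
  have "integrable lborel (\<lambda>x. a\<^sup>2 * (f x)\<^sup>2 + b\<^sup>2 * (g x)\<^sup>2 + 2 * a * b * (f x * g x))"
    using assms integrable_mult_square_integrable[OF assms]
    by (auto simp: square_integrable_def)
  moreover have "(\<lambda>x. a\<^sup>2 * (f x)\<^sup>2 + b\<^sup>2 * (g x)\<^sup>2 + 2 * a * b * (f x * g x)) = (\<lambda>x. (a * f x + b * g x)\<^sup>2)"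
    by (auto simp: power2_eq_square algebra_simps)
  ultimately show ?thesis using assms by (auto simp: square_integrable_def)
qed

text \<open>The positive and negative parts of \<open>h\<close> are densities of two measures that
  are finite and equal on every ray \<open>{a<..}\<close>. Rays determine such measures, so the two
  densities agree almost everywhere.\<close>

lemma AE_zero_if_tail_integrals_zero:
  fixes h :: "real \<Rightarrow> real"
  assumes h: "integrable lborel h"
    and zero: "\<And>a. (LINT x|lborel. h x * indicator {a<..} x) = 0"
  shows "AE x in lborel. h x = 0"
proof -
  have [measurable]: "h \<in> borel_measurable borel" using h by auto
  define P where "P = (\<lambda>x. ennreal (max 0 (h x)))"
  define N where "N = (\<lambda>x. ennreal (max 0 (- h x)))"
  have [measurable]: "P \<in> borel_measurable borel" "N \<in> borel_measurable borel"
    by (auto simp: P_def N_def)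
  have iP: "integrable lborel (\<lambda>x. max 0 (h x))" and iN: "integrable lborel (\<lambda>x. max 0 (- h x))"
    using h by auto
  have iP': "integrable lborel (\<lambda>x. max 0 (h x) * indicator {a<..} x)"
    and iN': "integrable lborel (\<lambda>x. max 0 (- h x) * indicator {a<..} x)" for a
    by (intro integrable_real_mult_indicator iP iN; simp)+
  have eP: "emeasure (density lborel P) {a<..} = ennreal (LINT x|lborel. max 0 (h x) * indicator {a<..} x)" for a
  proof -
    have "emeasure (density lborel P) {a<..} = (\<integral>\<^sup>+ x. ennreal (max 0 (h x) * indicator {a<..} x) \<partial>lborel)"
      by (subst emeasure_density) (auto intro!: nn_integral_cong simp: P_def indicator_def)
    also have "\<dots> = ennreal (LINT x|lborel. max 0 (h x) * indicator {a<..} x)"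
      by (rule nn_integral_eq_integral[OF iP']) auto
    finally show ?thesis .
  qed
  have eN: "emeasure (density lborel N) {a<..} = ennreal (LINT x|lborel. max 0 (- h x) * indicator {a<..} x)" for a
  proof -
    have "emeasure (density lborel N) {a<..} = (\<integral>\<^sup>+ x. ennreal (max 0 (- h x) * indicator {a<..} x) \<partial>lborel)"
      by (subst emeasure_density) (auto intro!: nn_integral_cong simp: N_def indicator_def)
    also have "\<dots> = ennreal (LINT x|lborel. max 0 (- h x) * indicator {a<..} x)"
      by (rule nn_integral_eq_integral[OF iN']) auto
    finally show ?thesis .
  qed
  have eq: "(LINT x|lborel. max 0 (h x) * indicator {a<..} x) = (LINT x|lborel. max 0 (- h x) * indicator {a<..} x)" for a
  proof -
    have "(LINT x|lborel. max 0 (h x) * indicator {a<..} x) - (LINT x|lborel. max 0 (- h x) * indicator {a<..} x)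
       = (LINT x|lborel. h x * indicator {a<..} x)"
      by (subst Bochner_Integration.integral_diff[symmetric, OF iP' iN'])
        (auto intro!: Bochner_Integration.integral_cong simp: indicator_def max_def)
    then show ?thesis using zero by simp
  qed
  have "density lborel P = density lborel N"
    by (rule measure_eqI_lessThan) (auto simp: eP eN eq)
  moreover have "(\<integral>\<^sup>+ x. P x \<partial>lborel) \<noteq> \<infinity>"
    using nn_integral_eq_integral[OF iP] by (simp add: P_def)
  ultimately have "AE x in lborel. P x = N x"
    by (intro sigma_finite_measure.density_unique[OF sigma_finite_lborel]) auto
  then show ?thesis
    by eventually_elim (auto simp: P_def N_def max_def split: if_splits)
qed

text \<open>The test functions \<open>n k / (1 + n k)\<close> with the \<open>C\<^sup>1\<close> bump \<open>k\<close> increase to the indicator of an interval.\<close>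

definition bump :: "real \<Rightarrow> real \<Rightarrow> real \<Rightarrow> real" where
  "bump a b x = (max 0 ((x - a) * (b - x)))\<^sup>2"

definition bump' :: "real \<Rightarrow> real \<Rightarrow> real \<Rightarrow> real" where
  "bump' a b x = 2 * max 0 ((x - a) * (b - x)) * (a + b - 2 * x)"

text \<open>Squaring removes the kink of \<open>max 0\<close>: at the origin the difference quotient
  is bounded by the size of the increment. This is why \<open>bump\<close> is continuously
  differentiable.\<close>

lemma DERIV_max0_square: "((\<lambda>t::real. (max 0 t)\<^sup>2) has_real_derivative 2 * max 0 t) (at t)"
proof (cases "t = 0")
  case True
  have "((\<lambda>h::real. (max 0 (0 + h))\<^sup>2 / h) \<longlongrightarrow> 0) (at 0)"
  proof (rule Lim_null_comparison)
    show "\<forall>\<^sub>F x in at 0. norm ((max 0 (0 + x))\<^sup>2 / x) \<le> \<bar>x\<bar>"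
      by (auto simp: eventually_at_filter max_def power2_eq_square)
    show "((\<lambda>x::real. \<bar>x\<bar>) \<longlongrightarrow> 0) (at 0)"
      by (auto intro!: tendsto_eq_intros)
  qed
  then show ?thesis using True by (simp add: DERIV_def)
next
  case False
  show ?thesis
  proof (cases "t > 0")
    case True
    have "((\<lambda>t. t\<^sup>2) has_real_derivative 2 * max 0 t) (at t)"
      using True by (auto intro!: derivative_eq_intros)
    then show ?thesis
      by (rule has_field_derivative_transform_within[where d = t])
        (use True in \<open>auto simp: dist_real_def\<close>)
  next
    case neg: False
    have "((\<lambda>t. 0) has_real_derivative 2 * max 0 t) (at t)"
      using neg by (auto intro!: derivative_eq_intros)
    then show ?thesis
      by (rule has_field_derivative_transform_within[where d = "- t"])
        (use neg False in \<open>auto simp: dist_real_def max_def\<close>)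
  qed
qed

lemma DERIV_bump: "(bump a b has_real_derivative bump' a b x) (at x)"
proof -
  have "((\<lambda>x. (x - a) * (b - x)) has_real_derivative (a + b - 2 * x)) (at x)"
    by (auto intro!: derivative_eq_intros)
  from DERIV_chain2[OF DERIV_max0_square this] show ?thesis
    by (simp add: bump_def[abs_def] bump'_def)
qed

lemma test_functionI:
  assumes "\<And>x. (f has_real_derivative f' x) (at x)" "continuous_on UNIV f'"
    and "\<And>x. \<bar>x\<bar> > R \<Longrightarrow> f x = 0"
  shows "test_function f"
proof -
  have d: "deriv f = f'" using assms(1) by (auto intro!: DERIV_imp_deriv)
  show "test_function f"
    unfolding test_function_def d
    using assms by (auto simp: differentiable_on_def real_differentiable_def
      intro: DERIV_subset)
qed

lemma test_function_cutoff:
  fixes n :: nat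
  shows "test_function (\<lambda>x. real n * bump a b x / (1 + real n * bump a b x))"
proof -
  have nz: "1 + real n * bump a b x > 0" for x
    by (auto simp: bump_def intro: add_pos_nonneg)
  show ?thesis
  proof (rule test_functionI)
    fix x
    show "((\<lambda>x. real n * bump a b x / (1 + real n * bump a b x)) has_real_derivative
        (real n * bump' a b x / (1 + real n * bump a b x)\<^sup>2)) (at x)"
      using nz[of x] by (auto intro!: derivative_eq_intros DERIV_bump simp: power2_eq_square field_simps)
    have "continuous_on UNIV (bump a b)" "continuous_on UNIV (bump' a b)"
      by (auto simp: bump_def[abs_def] bump'_def[abs_def] intro!: continuous_intros)
    then show "continuous_on UNIV (\<lambda>x. (real n * bump' a b x / (1 + real n * bump a b x)\<^sup>2))"
      using nz by (intro continuous_intros ballI) (auto simp: less_imp_neq[symmetric])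
    assume "\<bar>x\<bar> > \<bar>a\<bar> + \<bar>b\<bar>"
    then have "(x - a) * (b - x) \<le> 0"
      by (cases "x > 0") (auto simp: mult_le_0_iff)
    then show "real n * bump a b x / (1 + real n * bump a b x) = 0"
      by (simp add: bump_def max_def)
  qed
qed

lemma divide_shift_LIMSEQ: "(\<lambda>n. real n * k / (1 + real n * k)) \<longlonglongrightarrow> 1" if "k > 0"
proof -
  have "filterlim (\<lambda>n. 1 + real n * k) at_top sequentially"
    by (rule filterlim_tendsto_add_at_top[OF tendsto_const
          filterlim_at_top_mult_tendsto_pos[OF tendsto_const that filterlim_real_sequentially]])
  then have "(\<lambda>n. 1 / (1 + real n * k)) \<longlonglongrightarrow> 0"
    by (intro tendsto_divide_0[OF tendsto_const] filterlim_at_top_imp_at_infinity)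
  then have "(\<lambda>n. 1 - 1 / (1 + real n * k)) \<longlonglongrightarrow> 1 - 0"
    by (intro tendsto_diff tendsto_const)
  moreover have "1 - 1 / (1 + real n * k) = real n * k / (1 + real n * k)" for n
    using that by (simp add: field_simps add_nonneg_eq_0_iff)
  ultimately show ?thesis by simp
qed

lemma cutoff_LIMSEQ:
  "(\<lambda>n. real n * bump a b x / (1 + real n * bump a b x)) \<longlonglongrightarrow> indicator {a<..<b} x" if "a < b"
proof (cases "x \<in> {a<..<b}")
  case True
  then have "bump a b x > 0" by (auto simp: bump_def max_def)
  then have "(\<lambda>n. real n * bump a b x / (1 + real n * bump a b x)) \<longlonglongrightarrow> 1"
    by (rule divide_shift_LIMSEQ)
  then show ?thesis using True by simp
next
  case False
  then have "(x - a) * (b - x) \<le> 0" using that by (auto simp: mult_le_0_iff)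
  then have "bump a b x = 0" by (simp add: bump_def max_def)
  then show ?thesis using False by simp
qed

text \<open>Supplies the majorant for dominated convergence along the cutoffs.\<close>

lemma cutoff_bounded:
  assumes "a < b"
  shows "\<bar>real n * bump a b x / (1 + real n * bump a b x)\<bar> \<le> indicator {a..b} x"
proof (cases "x \<in> {a..b}")
  case True
  have "bump a b x \<ge> 0" by (simp add: bump_def)
  then have "real n * bump a b x \<ge> 0" by simp
  then show ?thesis using True by (simp add: divide_le_eq)
next
  case False
  then have "(x - a) * (b - x) \<le> 0" using assms by (auto simp: mult_le_0_iff)
  then have "bump a b x = 0" by (simp add: bump_def max_def)
  then show ?thesis by simp
qed


section \<open>Classical derivatives as weak derivatives\<close>

lemma test_function_bounded:
  assumes "test_function \<phi>"
  obtains R where "R > 0" "\<And>x. \<bar>x\<bar> > R \<Longrightarrow> \<phi> x = 0" "\<And>x. \<bar>x\<bar> > R \<Longrightarrow> deriv \<phi> x = 0"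
proof -
  obtain R where R: "\<And>x. \<bar>x\<bar> > R \<Longrightarrow> \<phi> x = 0"
    using assms by (auto simp: test_function_def)
  have "deriv \<phi> x = 0" if "\<bar>x\<bar> > max R 1" for x
  proof (rule DERIV_imp_deriv)
    have "((\<lambda>x. 0) has_real_derivative 0) (at x)" by simp
    then show "(\<phi> has_real_derivative 0) (at x)"
      by (rule has_field_derivative_transform_within[where d = "\<bar>x\<bar> - max R 1"])
        (use that R in \<open>auto simp: dist_real_def\<close>)
  qed
  then show ?thesis using R by (intro that[of "max R 1"]) auto
qed

lemma test_function_DERIV:
  "test_function \<phi> \<Longrightarrow> (\<phi> has_real_derivative deriv \<phi> x) (at x)"
  by (auto simp: test_function_def differentiable_on_def DERIV_deriv_iff_real_differentiable)

lemma test_function_integrable: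
  assumes \<phi>: "test_function \<phi>" and f: "continuous_on UNIV f"
  shows "integrable lborel (\<lambda>x. f x * \<phi> x)" "integrable lborel (\<lambda>x. f x * deriv \<phi> x)"
proof -
  obtain R where R: "R > 0" "\<And>x. \<bar>x\<bar> > R \<Longrightarrow> \<phi> x = 0" "\<And>x. \<bar>x\<bar> > R \<Longrightarrow> deriv \<phi> x = 0"
    using test_function_bounded[OF \<phi>] by metis
  have c: "continuous_on UNIV \<phi>"
    using test_function_DERIV[OF \<phi>] DERIV_continuous_on by blast
  have c': "continuous_on UNIV (deriv \<phi>)" using \<phi> by (auto simp: test_function_def)
  have *: "integrable lborel (\<lambda>x. f x * g x)" if g: "continuous_on UNIV g" "\<And>x. \<bar>x\<bar> > R \<Longrightarrow> g x = 0" for g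
  proof -
    have "set_integrable lborel {-R..R} (\<lambda>x. f x * g x)"
      using f g by (intro borel_integrable_atLeastAtMost' continuous_intros) (auto intro: continuous_on_subset)
    moreover have "(\<lambda>x. indicator {-R..R} x *\<^sub>R (f x * g x)) = (\<lambda>x. f x * g x)"
    proof
      show "indicator {-R..R} x *\<^sub>R (f x * g x) = f x * g x" for x
        using g(2)[of x] by (cases "\<bar>x\<bar> > R") (auto simp: indicator_def)
    qed
    ultimately show ?thesis by (simp only: set_integrable_def)
  qed
  show "integrable lborel (\<lambda>x. f x * \<phi> x)" "integrable lborel (\<lambda>x. f x * deriv \<phi> x)"
    using * c c' R by blast+
qed

lemma has_weak_deriv_classical:
  assumes f: "\<And>x. (f has_real_derivative f' x) (at x)" and f': "continuous_on UNIV f'"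
  shows "has_weak_deriv f f'"
  unfolding has_weak_deriv_def
proof (intro allI impI)
  fix \<phi> assume \<phi>: "test_function \<phi>"
  obtain R where R: "R > 0" "\<And>x. \<bar>x\<bar> > R \<Longrightarrow> \<phi> x = 0" "\<And>x. \<bar>x\<bar> > R \<Longrightarrow> deriv \<phi> x = 0"
    using test_function_bounded[OF \<phi>] by metis
  have c: "continuous_on UNIV f" using f DERIV_continuous_on by blast
  have c\<phi>: "continuous_on UNIV \<phi>" "continuous_on UNIV (deriv \<phi>)"
    using \<phi> DERIV_continuous_on[OF test_function_DERIV[OF \<phi>]] by (simp_all add: test_function_def)
  have i: "integrable lborel (\<lambda>x. f x * deriv \<phi> x)" "integrable lborel (\<lambda>x. f' x * \<phi> x)"
    using test_function_integrable \<phi> c f' by auto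
  \<comment> \<open>The test function is known to vanish only strictly beyond \<open>R\<close>, so
    the interval is enlarged to kill the boundary terms.\<close>
  define S where "S = R + 1"
  have "(LINT x|lborel. f x * deriv \<phi> x) + (LINT x|lborel. f' x * \<phi> x)
    = (LINT x|lborel. f x * deriv \<phi> x + f' x * \<phi> x)"
    using i by simp
  also have "\<dots> = (LINT x|lborel. indicator {-S..S} x *\<^sub>R (f x * deriv \<phi> x + f' x * \<phi> x))"
  proof (intro Bochner_Integration.integral_cong refl)
    show "f x * deriv \<phi> x + f' x * \<phi> x = indicator {-S..S} x *\<^sub>R (f x * deriv \<phi> x + f' x * \<phi> x)" for x
      using R(2,3)[of x] by (cases "\<bar>x\<bar> > R") (auto simp: indicator_def S_def)
  qed
  also have "\<dots> = f S * \<phi> S - f (- S) * \<phi> (- S)"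
  proof (rule integral_FTC_atLeastAtMost)
    show "- S \<le> S" using R by (simp add: S_def)
    show "((\<lambda>x. f x * \<phi> x) has_vector_derivative f x * deriv \<phi> x + f' x * \<phi> x) (at x within {-S..S})" for x
      using DERIV_mult[OF f[of x] test_function_DERIV[OF \<phi>, of x]]
      by (auto simp: has_real_derivative_iff_has_vector_derivative algebra_simps intro: has_vector_derivative_at_within)
    show "continuous_on {-S..S} (\<lambda>x. f x * deriv \<phi> x + f' x * \<phi> x)"
      using c c\<phi> f' by (intro continuous_intros) (auto intro: continuous_on_subset)
  qed
  also have "\<dots> = 0" using R by (simp add: S_def)
  finally show "(LINT x|lborel. f x * deriv \<phi> x) = - (LINT x|lborel. f' x * \<phi> x)"
    by simp
qed

text \<open>Both \<open>g\<close> and \<open>f'\<close> are weak derivatives of \<open>f\<close>, so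
  \<open>g - f'\<close> integrates to zero against every cutoff. Dominated convergence carries this
  over to bounded open intervals.\<close>

lemma weak_deriv_unique_AE:
  assumes f: "\<And>x. (f has_real_derivative f' x) (at x)" and f': "continuous_on UNIV f'"
    and g: "square_integrable g" "has_weak_deriv f g"
  shows "AE x in lborel. g x = f' x"
proof -
  have gm [measurable]: "g \<in> borel_measurable borel" using g by (auto simp: square_integrable_def)
  have fm [measurable]: "f' \<in> borel_measurable borel" using f' borel_measurable_continuous_onI by blast
  have loc: "integrable lborel (\<lambda>x. (g x - f' x) * indicator {a..b} x)" for a b :: real
  proof -
    have "square_integrable (indicator {a..b} :: real \<Rightarrow> real)"
      by (simp add: square_integrable_def power2_eq_square indicator_inter_arith[symmetric]
          integrable_indicator_iff emeasure_lborel_Icc_eq)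
    then have "integrable lborel (\<lambda>x. g x * indicator {a..b} x)"
      by (rule integrable_mult_square_integrable[OF g(1)])
    moreover have "integrable lborel (\<lambda>x. f' x * indicator {a..b} x)"
      using borel_integrable_atLeastAtMost'[of a b f'] f'
      by (auto simp: set_integrable_def mult.commute intro: continuous_on_subset)
    ultimately show ?thesis by (simp add: left_diff_distrib)
  qed
  have int0: "(LINT x|lborel. (g x - f' x) * indicator {a<..<b} x) = 0" if "a < b" for a b
  proof -
    define c where "c = (\<lambda>n x. real n * bump a b x / (1 + real n * bump a b x))"
    have tf: "test_function (c n)" for n unfolding c_def by (rule test_function_cutoff)
    have cm [measurable]: "c n \<in> borel_measurable borel" for n
      using tf[of n] test_function_DERIV DERIV_continuous_on borel_measurable_continuous_onI by metis
    have bd: "\<bar>c n x\<bar> \<le> indicator {a..b} x" for n x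
      using cutoff_bounded[OF that] by (simp add: c_def)
    have "(LINT x|lborel. (g x - f' x) * c n x) = 0" for n
    proof -
      have "integrable lborel (\<lambda>x. (g x - f' x) * c n x)"
      proof (rule Bochner_Integration.integrable_bound[OF loc[of a b]])
        show "AE x in lborel. norm ((g x - f' x) * c n x) \<le> norm ((g x - f' x) * indicator {a..b} x)"
          using bd[of n] by (auto simp: abs_mult intro!: mult_left_mono)
      qed auto
      moreover have "integrable lborel (\<lambda>x. f' x * c n x)"
        using test_function_integrable(1)[OF tf f'] .
      moreover from calculation have "integrable lborel (\<lambda>x. (g x - f' x) * c n x + f' x * c n x)"
        by (rule Bochner_Integration.integrable_add)
      then have "integrable lborel (\<lambda>x. g x * c n x)" by (simp add: algebra_simps)
      ultimately have "(LINT x|lborel. (g x - f' x) * c n x)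
          = (LINT x|lborel. g x * c n x) - (LINT x|lborel. f' x * c n x)"
        by (simp add: left_diff_distrib)
      then show ?thesis
        using tf[of n] g(2) has_weak_deriv_classical[of f f', OF f f'] by (auto simp: has_weak_deriv_def)
    qed
    moreover have "(\<lambda>n. LINT x|lborel. (g x - f' x) * c n x)
        \<longlonglongrightarrow> (LINT x|lborel. (g x - f' x) * indicator {a<..<b} x)"
    proof (rule integral_dominated_convergence[where w = "\<lambda>x. \<bar>(g x - f' x) * indicator {a..b} x\<bar>"])
      show "AE x in lborel. (\<lambda>n. (g x - f' x) * c n x) \<longlonglongrightarrow> (g x - f' x) * indicator {a<..<b} x"
        unfolding c_def by (intro AE_I2 tendsto_mult_left cutoff_LIMSEQ that)
      show "AE x in lborel. norm ((g x - f' x) * c n x) \<le> \<bar>(g x - f' x) * indicator {a..b} x\<bar>" for n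
        using bd[of n] by (auto simp: abs_mult intro!: mult_left_mono)
      show "integrable lborel (\<lambda>x. \<bar>(g x - f' x) * indicator {a..b} x\<bar>)"
        by (intro integrable_abs loc)
    qed auto
    ultimately show ?thesis by (simp add: LIMSEQ_const_iff)
  qed
  \<comment> \<open>The tail criterion asks for integrability on the whole line, while
    \<open>g - f'\<close> is only locally integrable; hence the truncation to symmetric intervals
    that exhaust the line.\<close>
  have "AE x in lborel. (g x - f' x) * indicator {- real n<..<real n} x = 0" for n
  proof (rule AE_zero_if_tail_integrals_zero)
    have "integrable lborel (\<lambda>x. ((g x - f' x) * indicator {- real n..real n} x) * indicator {- real n<..<real n} x)"
      by (intro integrable_real_mult_indicator loc) simp
    moreover have "indicator {- real n..real n} x * indicator {- real n<..<real n} x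
      = (indicator {- real n<..<real n} x :: real)" for x
      by (auto simp: indicator_def)
    ultimately show "integrable lborel (\<lambda>x. (g x - f' x) * indicator {- real n<..<real n} x)"
      by (simp add: mult.assoc)
    fix a
    have "(LINT x|lborel. (g x - f' x) * indicator {- real n<..<real n} x * indicator {a<..} x)
      = (LINT x|lborel. (g x - f' x) * indicator {max a (- real n)<..<real n} x)"
      by (intro Bochner_Integration.integral_cong) (auto simp: indicator_def)
    also have "\<dots> = 0"
      by (cases "max a (- real n) < real n") (use int0 in \<open>auto simp: greaterThanLessThan_empty\<close>)
    finally show "(LINT x|lborel. (g x - f' x) * indicator {- real n<..<real n} x * indicator {a<..} x) = 0" .
  qed
  then have "AE x in lborel. \<forall>n. (g x - f' x) * indicator {- real n<..<real n} x = 0"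
    by (subst AE_all_countable) blast
  then show ?thesis
  proof eventually_elim
    case (elim x)
    obtain n where "\<bar>x\<bar> < real n" using reals_Archimedean2 by blast
    then show ?case using elim[rule_format, of n] by (auto simp: indicator_def abs_less_iff)
  qed
qed


section \<open>Continuously differentiable elements of \<open>H1\<close> and the energy norm\<close>

definition H1_classical :: "(real \<Rightarrow> real) \<Rightarrow> (real \<Rightarrow> real) \<Rightarrow> bool" where
  "H1_classical f f' \<longleftrightarrow> (\<forall>x. (f has_real_derivative f' x) (at x)) \<and> continuous_on UNIV f' \<and>
     square_integrable f \<and> square_integrable f'"

text \<open>Square integrability of \<open>f'\<close> is inherited from the weak derivative provided
  by \<open>H1\<close>, which equals \<open>f'\<close> almost everywhere.\<close>

lemma H1_classicalI:
  assumes f: "\<And>x. (f has_real_derivative f' x) (at x)" and f': "continuous_on UNIV f'" and H: "f \<in> H1"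
  shows "H1_classical f f'"
proof -
  obtain g where g: "square_integrable g" "has_weak_deriv f g" using H by (auto simp: H1_def)
  have AE: "AE x in lborel. (g x)\<^sup>2 = (f' x)\<^sup>2"
    using weak_deriv_unique_AE[OF f f' g] by eventually_elim simp
  have [measurable]: "g \<in> borel_measurable borel" "f' \<in> borel_measurable borel"
    using g f' by (auto simp: square_integrable_def intro: borel_measurable_continuous_onI)
  have "integrable lborel (\<lambda>x. (f' x)\<^sup>2)"
    using integrable_cong_AE[OF _ _ AE] g by (simp add: square_integrable_def)
  then show ?thesis using f f' H by (simp add: H1_classical_def H1_def square_integrable_def)
qed

lemma H1_classical_imp_H1:
  assumes "H1_classical f f'"
  shows "f \<in> H1"
  using assms has_weak_deriv_classical[of f f'] by (auto simp: H1_classical_def H1_def)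

text \<open>The energy norm uses an arbitrarily chosen weak derivative. Uniqueness up to null sets
  makes the integral independent of that choice.\<close>

lemma integral_weak_deriv_square:
  assumes "H1_classical f f'"
  shows "(LINT x|lborel. (weak_deriv f x)\<^sup>2) = (LINT x|lborel. (f' x)\<^sup>2)"
proof -
  have "\<exists>g. square_integrable g \<and> has_weak_deriv f g"
    using H1_classical_imp_H1[OF assms] by (auto simp: H1_def)
  then have g: "square_integrable (weak_deriv f)" "has_weak_deriv f (weak_deriv f)"
    using someI_ex[of "\<lambda>g. square_integrable g \<and> has_weak_deriv f g"] by (simp_all add: weak_deriv_def)
  have f: "\<And>x. (f has_real_derivative f' x) (at x)" "continuous_on UNIV f'"
    using assms by (auto simp: H1_classical_def)
  have [measurable]: "weak_deriv f \<in> borel_measurable borel" "f' \<in> borel_measurable borel"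
    using g f by (auto simp: square_integrable_def intro: borel_measurable_continuous_onI)
  show ?thesis
    by (rule integral_cong_AE) (use weak_deriv_unique_AE[OF f g] in auto)
qed

lemma H1_classical_combination:
  assumes "H1_classical f f'" "H1_classical g g'"
  shows "H1_classical (\<lambda>x. a * f x + b * g x) (\<lambda>x. a * f' x + b * g' x)"
  using assms unfolding H1_classical_def
  by (auto intro!: derivative_eq_intros continuous_intros square_integrable_combination)

lemma H1_classical_zero: "H1_classical (\<lambda>x. 0) (\<lambda>x. 0)"
  by (auto simp: H1_classical_def square_integrable_def)

lemma H1_classical_cmult:
  "H1_classical f f' \<Longrightarrow> H1_classical (\<lambda>x. a * f x) (\<lambda>x. a * f' x)"
  using H1_classical_combination[of f f' f f' a 0] by simp

lemma square_integrable_reflect: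
  "square_integrable f \<Longrightarrow> square_integrable (\<lambda>x. f (- x))"
  using lborel_integrable_real_affine[of "\<lambda>x. (f x)\<^sup>2" "-1" 0]
  by (auto simp: square_integrable_def)

lemma H1_classical_reflect:
  assumes "H1_classical f f'"
  shows "H1_classical (\<lambda>x. f (- x)) (\<lambda>x. - f' (- x))"
proof -
  have "((\<lambda>x. f (- x)) has_real_derivative - f' (- x)) (at x)" for x
    using assms by (simp add: H1_classical_def DERIV_mirror[symmetric])
  moreover have "continuous_on UNIV (\<lambda>x. - f' (- x))"
    using assms by (auto simp: H1_classical_def intro!: continuous_intros continuous_on_compose2[of UNIV f'])
  moreover have "square_integrable (\<lambda>x. - f' (- x))"
    using square_integrable_reflect[of f'] assms
    by (auto simp: H1_classical_def square_integrable_def)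
  ultimately show ?thesis
    using assms square_integrable_reflect[of f] by (auto simp: H1_classical_def)
qed

text \<open>Replaces all limits at infinity below: a function that stays above a positive constant
  on a ray has integral at least \<open>c * N\<close> for every \<open>N\<close>.\<close>

lemma not_integrable_if_bounded_below_right:
  fixes F :: "real \<Rightarrow> real"
  assumes F: "integrable lborel F" and "c > 0" and ge: "\<And>x. x \<ge> a \<Longrightarrow> F x \<ge> c"
  shows False
proof -
  have i: "integrable lborel (\<lambda>x. \<bar>F x\<bar>)" using F by simp
  define N where "N = nat \<lceil>(LINT x|lborel. \<bar>F x\<bar>) / c\<rceil> + 1"
  have "c * real N = (LINT x|lborel. c * indicator {a..a + real N} x)" by simp
  also have "\<dots> \<le> (LINT x|lborel. \<bar>F x\<bar>)"
  proof (rule integral_mono[OF _ i])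
    show "integrable lborel (\<lambda>x. c * indicator {a..a + real N} x)"
      by (intro integrable_mult_right) (simp add: integrable_indicator_iff emeasure_lborel_Icc_eq)
    show "c * indicator {a..a + real N} x \<le> \<bar>F x\<bar>" for x
      using ge[of x] by (auto simp: indicator_def)
  qed
  also have "\<dots> < c * real N"
  proof -
    have "(LINT x|lborel. \<bar>F x\<bar>) / c < real N" unfolding N_def by linarith
    then show ?thesis using \<open>c > 0\<close> by (simp add: divide_less_eq mult.commute)
  qed
  finally show False by simp
qed

text \<open>Since \<open>2 * f * f'\<close> is at least minus the sum of the squares,
  \<open>f\<^sup>2\<close> can drop by at most the right-hand side when moving to the right of
  \<open>x\<close>. If it started above that value, it would stay above a positive constant
  forever.\<close>

lemma sobolev_bound:
  assumes "H1_classical f f'"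
  shows "(f x)\<^sup>2 \<le> (LINT y|lborel. (f y)\<^sup>2) + (LINT y|lborel. (f' y)\<^sup>2)"
proof (rule ccontr)
  define E where "E = (LINT y|lborel. (f y)\<^sup>2) + (LINT y|lborel. (f' y)\<^sup>2)"
  assume "\<not> ?thesis"
  then have gt: "(f x)\<^sup>2 - E > 0" by (simp add: E_def)
  have f: "\<And>x. (f has_real_derivative f' x) (at x)" "continuous_on UNIV f'"
    and sq: "integrable lborel (\<lambda>x. (f x)\<^sup>2)" "integrable lborel (\<lambda>x. (f' x)\<^sup>2)"
    using assms by (auto simp: H1_classical_def square_integrable_def)
  have cf: "continuous_on UNIV f" using f(1) DERIV_continuous_on by blast
  have "(f y)\<^sup>2 \<ge> (f x)\<^sup>2 - E" if "y \<ge> x" for y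
  proof -
    have "(LINT t|lborel. indicator {x..y} t *\<^sub>R (2 * f t * f' t)) = (f y)\<^sup>2 - (f x)\<^sup>2"
    proof (rule integral_FTC_atLeastAtMost[OF that])
      show "((\<lambda>t. (f t)\<^sup>2) has_vector_derivative 2 * f t * f' t) (at t within {x..y})" for t
        unfolding has_real_derivative_iff_has_vector_derivative[symmetric]
        by (auto intro!: derivative_eq_intros DERIV_subset[OF f(1)])
      show "continuous_on {x..y} (\<lambda>t. 2 * f t * f' t)"
        using cf f by (intro continuous_intros) (auto intro: continuous_on_subset)
    qed
    moreover have "(LINT t|lborel. - ((f t)\<^sup>2 + (f' t)\<^sup>2)) \<le> (LINT t|lborel. indicator {x..y} t *\<^sub>R (2 * f t * f' t))"
    proof (rule integral_mono)
      show "integrable lborel (\<lambda>t. - ((f t)\<^sup>2 + (f' t)\<^sup>2))" using sq by auto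
      have "set_integrable lborel {x..y} (\<lambda>t. 2 * f t * f' t)"
        using cf f by (intro borel_integrable_atLeastAtMost' continuous_intros) (auto intro: continuous_on_subset)
      then show "integrable lborel (\<lambda>t. indicator {x..y} t *\<^sub>R (2 * f t * f' t))"
        by (simp add: set_integrable_def)
      show "- ((f t)\<^sup>2 + (f' t)\<^sup>2) \<le> indicator {x..y} t *\<^sub>R (2 * f t * f' t)" for t
        using zero_le_power2[of "f t + f' t"] by (auto simp: indicator_def power2_sum add_nonneg_nonneg)
    qed
    moreover have "(LINT t|lborel. - ((f t)\<^sup>2 + (f' t)\<^sup>2)) = - E"
      unfolding E_def using sq by simp
    ultimately show ?thesis by linarith
  qed
  then show False
    using not_integrable_if_bounded_below_right[OF sq(1) gt] by blast
qed

lemma energy_norm_classical: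
  assumes "H1_classical f f'" "H1_classical g g'"
  shows "energy_norm (f, g) = sqrt (
     (LINT x|lborel. (f x)\<^sup>2) + (LINT x|lborel. (f' x)\<^sup>2) + (LINT x|lborel. (\<bar>x\<bar> * f x)\<^sup>2) +
     ((LINT x|lborel. (g x)\<^sup>2) + (LINT x|lborel. (g' x)\<^sup>2) + (LINT x|lborel. (\<bar>x\<bar> * g x)\<^sup>2)))"
  using assms by (simp add: energy_norm_def integral_weak_deriv_square)

lemma sup_le_energy_norm:
  assumes f: "H1_classical f f'" and g: "H1_classical g g'"
  shows "\<bar>f x\<bar> \<le> energy_norm (f, g)" "\<bar>g x\<bar> \<le> energy_norm (f, g)"
proof -
  have nn: "0 \<le> (LINT x|lborel. (h x)\<^sup>2)" for h :: "real \<Rightarrow> real" by simp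
  show "\<bar>f x\<bar> \<le> energy_norm (f, g)" "\<bar>g x\<bar> \<le> energy_norm (f, g)"
    unfolding energy_norm_classical[OF assms]
    using sobolev_bound[OF f, of x] sobolev_bound[OF g, of x] nn[of f] nn[of f'] nn[of g] nn[of g']
      nn[of "\<lambda>x. \<bar>x\<bar> * f x"] nn[of "\<lambda>x. \<bar>x\<bar> * g x"]
    by (intro real_le_rsqrt; simp add: power2_abs; linarith)+
qed

lemma energy_norm_scaled:
  assumes "H1_classical f f'"
  shows "energy_norm ((\<lambda>x. a * f x), (\<lambda>x. b * f x)) = sqrt (a\<^sup>2 + b\<^sup>2) *
    sqrt ((LINT x|lborel. (f x)\<^sup>2) + (LINT x|lborel. (f' x)\<^sup>2) + (LINT x|lborel. (\<bar>x\<bar> * f x)\<^sup>2))"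
proof -
  have "\<bar>x\<bar> * (c * f x) = c * (\<bar>x\<bar> * f x)" for c x by simp
  then show ?thesis
    unfolding energy_norm_classical[OF H1_classical_cmult[OF assms] H1_classical_cmult[OF assms]]
    by (simp only: power_mult_distrib integral_mult_right_zero real_sqrt_mult[symmetric])
      (simp add: algebra_simps)
qed

section \<open>Sturm-type comparison on half-lines\<close>

text \<open>While \<open>g\<close> is negative, \<open>h\<close> does not increase and so stays
  nonpositive; then \<open>g' = p * h\<close> is nonpositive and \<open>g\<close> cannot climb back.
  A first return point of \<open>g\<close> to the nonnegative values is therefore impossible. The
  weight \<open>p\<close> admits quotients, whose derivative is a Wronskian over a square.\<close>

lemma trapped_right:
  fixes g h :: "real \<Rightarrow> real"
  assumes g: "\<And>x. a \<le> x \<Longrightarrow> (g has_real_derivative p x * h x) (at x)"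
    and p: "\<And>x. a \<le> x \<Longrightarrow> 0 \<le> p x"
    and h: "\<And>x. a \<le> x \<Longrightarrow> (h has_real_derivative h' x) (at x)"
    and neg: "\<And>x. a \<le> x \<Longrightarrow> g x < 0 \<Longrightarrow> h' x \<le> 0"
    and a: "g a < 0" "h a \<le> 0" and "a \<le> x"
  shows "g x \<le> g a" "h x \<le> h a"
proof -
  have cont: "continuous_on {a..b} g" "continuous_on {a..b} h" for b
    by (rule DERIV_atLeastAtMost_imp_continuous_on, rule exI, erule g)
      (rule DERIV_atLeastAtMost_imp_continuous_on, rule exI, erule h)
  have down: "h t \<le> h a \<and> g t \<le> g a" if "a \<le> b" and b: "\<And>t. a \<le> t \<Longrightarrow> t < b \<Longrightarrow> g t < 0"
    and t: "a \<le> t" "t \<le> b" for b t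
  proof -
    have hle: "h s \<le> h a" if "a \<le> s" "s \<le> b" for s
      using \<open>a \<le> s\<close>
    proof (rule DERIV_nonpos_imp_decreasing_open)
      fix t assume "a < t" "t < s"
      then have "a \<le> t" "g t < 0" using b that by auto
      then show "\<exists>y. (h has_real_derivative y) (at t) \<and> y \<le> 0"
        using h neg by blast
    qed (rule cont)
    have "g t \<le> g a"
    proof (rule DERIV_nonpos_imp_nonincreasing[OF t(1)])
      fix s assume "a \<le> s" "s \<le> t"
      then have "p s * h s \<le> 0" using p[of s] hle[of s] a t by (intro mult_nonneg_nonpos) auto
      then show "\<exists>y. (g has_real_derivative y) (at s) \<and> y \<le> 0"
        using g[OF \<open>a \<le> s\<close>] by blast
    qed
    then show ?thesis using hle[OF t] by simp
  qed
  have "g t < 0" if "a \<le> t" for t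
  proof (rule ccontr)
    assume "\<not> g t < 0"
    define S where "S = {s \<in> {a..t}. 0 \<le> g s}"
    have "S \<noteq> {}" using \<open>\<not> g t < 0\<close> that by (auto simp: S_def)
    moreover have "compact S"
    proof -
      have "S = {a..t} \<inter> g -` {0..}" by (auto simp: S_def)
      moreover have "closed ({a..t} \<inter> g -` {0..})"
        by (intro continuous_closed_preimage cont) auto
      moreover have "bounded ({a..t} \<inter> g -` {0..})"
        by (rule bounded_subset[OF bounded_closed_interval]) auto
      ultimately show ?thesis by (simp add: compact_eq_bounded_closed)
    qed
    ultimately obtain b where b: "b \<in> S" "\<And>s. s \<in> S \<Longrightarrow> b \<le> s"
      using compact_attains_inf by metis
    have ab: "a \<le> b" "b \<le> t" "0 \<le> g b" using b(1) by (auto simp: S_def)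
    have "g s < 0" if "a \<le> s" "s < b" for s
    proof (rule ccontr)
      assume "\<not> g s < 0"
      then have "s \<in> S" using that ab by (auto simp: S_def)
      then show False using b(2)[of s] that by simp
    qed
    then have "g b \<le> g a" using down[of b b] ab by blast
    then show False using ab a by simp
  qed
  then show "g x \<le> g a" "h x \<le> h a" using down[of x x] \<open>a \<le> x\<close> by blast+
qed

text \<open>If \<open>g\<close> became negative, just after the last nonnegative point it would be
  negative with negative slope at some \<open>t\<close>. Concavity on the negative set then traps it
  below \<open>g t\<close>, against square integrability.\<close>

lemma nonneg_right_tail:
  fixes g :: "real \<Rightarrow> real"
  assumes g: "\<And>x. (g has_real_derivative g' x) (at x)"
    and g': "\<And>x. (g' has_real_derivative g'' x) (at x)"
    and neg: "\<And>x. a \<le> x \<Longrightarrow> g x < 0 \<Longrightarrow> g'' x \<le> 0"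
    and int: "integrable lborel (\<lambda>x. (g x)\<^sup>2)"
    and a: "0 \<le> g a" and x: "a \<le> x"
  shows "0 \<le> g x"
proof (rule ccontr)
  assume nx: "\<not> 0 \<le> g x"
  have cont: "continuous_on UNIV g" using g DERIV_continuous_on by blast
  define S where "S = {s \<in> {a..x}. 0 \<le> g s}"
  have "S \<noteq> {}" using a x by (auto simp: S_def)
  moreover have "compact S"
  proof -
    have "S = {a..x} \<inter> g -` {0..}" by (auto simp: S_def)
    moreover have "closed (g -` {0..})"
      using cont by (simp add: closed_vimage continuous_on_eq_continuous_within continuous_at_imp_continuous_on)
    ultimately show ?thesis by (simp add: compact_Int_closed)
  qed
  ultimately obtain z where z: "z \<in> S" "\<And>s. s \<in> S \<Longrightarrow> s \<le> z"
    using compact_attains_sup by metis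
  have "z < x" using z(1) nx by (auto simp: S_def less_le)
  from MVT2[OF this g] obtain t where t: "z < t" "t < x" "g x - g z = (x - z) * g' t" by blast
  have "(x - z) * g' t < 0" using t(3) nx z(1) by (auto simp: S_def)
  then have "g' t < 0" using \<open>z < x\<close> by (simp add: mult_less_0_iff)
  moreover have "a \<le> t" using t z(1) by (auto simp: S_def)
  moreover have "g t < 0" using z(2)[of t] t \<open>a \<le> t\<close> by (auto simp: S_def not_le[symmetric])
  ultimately have le: "g y \<le> g t" if "t \<le> y" for y
    using trapped_right(1)[of t g "\<lambda>_. 1" g' g'' y] g g' neg that by auto
  show False
  proof (rule not_integrable_if_bounded_below_right[OF int, of "(g t)\<^sup>2" t])
    show "0 < (g t)\<^sup>2" using \<open>g t < 0\<close> by simp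
    show "(g t)\<^sup>2 \<le> (g y)\<^sup>2" if "t \<le> y" for y
      using le[OF that] \<open>g t < 0\<close> by (simp add: abs_le_square_iff[symmetric])
  qed
qed

text \<open>A zero of a nonnegative solution is a double zero, which is excluded by a one-sided form
  of uniqueness for the linear equation \<open>f'' = V f\<close>.\<close>

lemma pos_right_tail:
  fixes f :: "real \<Rightarrow> real"
  assumes f: "\<And>x. (f has_real_derivative f' x) (at x)"
    and f': "\<And>x. (f' has_real_derivative V x * f x) (at x)"
    and V: "continuous_on UNIV V"
    and nn: "\<And>x. a \<le> x \<Longrightarrow> 0 \<le> f x" and a: "0 < f a" and x: "a \<le> x"
  shows "0 < f x"
proof (rule ccontr)
  assume "\<not> 0 < f x"
  then have fx: "f x = 0" using nn[OF x] by simp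
  then have "a < x" using a x by (cases "a = x") auto
  have f'x: "f' x = 0"
    by (rule DERIV_local_min[OF f, of "x - a"]) (use \<open>a < x\<close> fx nn in auto)
  have "compact (V ` {a..x})"
    by (intro compact_continuous_image continuous_on_subset[OF V]) auto
  then obtain B where B: "\<And>y. y \<in> {a..x} \<Longrightarrow> \<bar>V y\<bar> \<le> B"
    unfolding compact_eq_bounded_closed bounded_iff by fastforce
  define k where "k = max 1 B"
  have k: "k \<ge> 1" "\<And>y. y \<in> {a..x} \<Longrightarrow> V y \<le> k\<^sup>2"
  proof -
    show "k \<ge> 1" by (simp add: k_def)
    then have "B \<le> k * k" using mult_mono[of 1 k B k] by (auto simp: k_def max_def split: if_splits)
    then show "V y \<le> k\<^sup>2" if "y \<in> {a..x}" for y using B[OF that] by (auto simp: power2_eq_square)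
  qed
  \<comment> \<open>From \<open>f'' = V f\<close> and \<open>V \<le> k\<^sup>2\<close>, the function
    \<open>f' - k * f\<close> multiplied by this integrating factor is nonincreasing. It vanishes at
    \<open>x\<close>, so \<open>f' \<ge> k * f \<ge> 0\<close> to the left of \<open>x\<close> and
    \<open>f a \<le> f x = 0\<close>.\<close>
  define Z where "Z = (\<lambda>y. (f' y - k * f y) * exp (k * y))"
  have Z: "(Z has_real_derivative (V y - k\<^sup>2) * f y * exp (k * y)) (at y)" for y
    unfolding Z_def
    by (auto intro!: derivative_eq_intros f f' simp: power2_eq_square algebra_simps)
  have "Z x \<le> Z y" if "a \<le> y" "y \<le> x" for y
  proof (rule DERIV_nonpos_imp_nonincreasing[OF that(2)])
    fix s assume "y \<le> s" "s \<le> x"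
    then have "(V s - k\<^sup>2) * f s * exp (k * s) \<le> 0"
      using k(2)[of s] nn[of s] that by (intro mult_nonpos_nonneg) auto
    then show "\<exists>d. (Z has_real_derivative d) (at s) \<and> d \<le> 0" using Z by blast
  qed
  then have "f' y \<ge> k * f y" if "a \<le> y" "y \<le> x" for y
    using that by (auto simp: Z_def fx f'x zero_le_mult_iff not_le[symmetric])
  moreover have "k * f y \<ge> 0" if "a \<le> y" for y using k(1) nn[OF that] by simp
  ultimately have "f' y \<ge> 0" if "a \<le> y" "y \<le> x" for y using that by fastforce
  then have "f a \<le> f x"
    by (intro DERIV_nonneg_imp_nondecreasing[OF x]) (use f in blast)
  then show False using a fx by simp
qed

lemma nonincreasing_integrable_nonneg:
  fixes F :: "real \<Rightarrow> real"
  assumes "integrable lborel F"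
    and F: "\<And>x. a \<le> x \<Longrightarrow> (F has_real_derivative F' x) (at x)" "\<And>x. a \<le> x \<Longrightarrow> F' x \<le> 0"
    and x: "a \<le> x"
  shows "0 \<le> F x"
proof (rule ccontr)
  assume "\<not> 0 \<le> F x"
  moreover have "F y \<le> F x" if "x \<le> y" for y
  proof (rule DERIV_nonpos_imp_nonincreasing[OF that])
    fix s assume "x \<le> s"
    then have "a \<le> s" using x by simp
    then show "\<exists>d. (F has_real_derivative d) (at s) \<and> d \<le> 0" using F by blast
  qed
  ultimately show False
    using not_integrable_if_bounded_below_right[of "\<lambda>x. - F x" "- F x" x] assms(1) by auto
qed

text \<open>A positive value would persist to the right and a negative one to the left. The second
  case is the first one after reflection.\<close>

lemma nondecreasing_integrable_zero:
  fixes F :: "real \<Rightarrow> real"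
  assumes int: "integrable lborel F"
    and F: "\<And>x. (F has_real_derivative F' x) (at x)" "\<And>x. 0 \<le> F' x"
  shows "F x = 0"
proof -
  have "0 \<le> - F x"
    by (rule nonincreasing_integrable_nonneg[of "\<lambda>x. - F x" x "\<lambda>x. - F' x"])
      (use assms in \<open>auto intro: DERIV_minus\<close>)
  moreover have "0 \<le> F x"
  proof -
    have "integrable lborel (\<lambda>x. F (- x))"
      using lborel_integrable_real_affine[OF int, of "-1" 0] by simp
    then show ?thesis
      using nonincreasing_integrable_nonneg[of "\<lambda>x. F (- x)" "- x" "\<lambda>x. - F' (- x)" "- x"] F
      by (auto simp: DERIV_mirror[symmetric])
  qed
  ultimately show ?thesis by simp
qed

section \<open>The coupled Gross--Pitaevskii system\<close>

text \<open>The equation of one component, solved for its second derivative: \<open>u\<close> is the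
  component itself and \<open>v\<close> the other one.\<close>

definition gp_force :: "real \<Rightarrow> real \<Rightarrow> real \<Rightarrow> real \<Rightarrow> real \<Rightarrow> real" where
  "gp_force \<epsilon> \<gamma> u v x = (x\<^sup>2 - 1 + u\<^sup>2 + \<gamma> * v\<^sup>2) / \<epsilon>\<^sup>2 * u"

definition gp_pair :: "real \<Rightarrow> real \<Rightarrow> (real \<Rightarrow> real) \<Rightarrow> (real \<Rightarrow> real) \<Rightarrow> (real \<Rightarrow> real) \<Rightarrow> (real \<Rightarrow> real) \<Rightarrow> bool" where
  "gp_pair \<epsilon> \<gamma> f f' g g' \<longleftrightarrow> H1_classical f f' \<and> H1_classical g g' \<and>
     (\<forall>x. (f' has_real_derivative gp_force \<epsilon> \<gamma> (f x) (g x) x) (at x)) \<and>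
     (\<forall>x. (g' has_real_derivative gp_force \<epsilon> \<gamma> (g x) (f x) x) (at x))"

lemma gp_pairD:
  assumes "gp_pair \<epsilon> \<gamma> f f' g g'"
  shows "H1_classical f f'" "H1_classical g g'"
    and "(f has_real_derivative f' x) (at x)" "(g has_real_derivative g' x) (at x)"
    and "(f' has_real_derivative gp_force \<epsilon> \<gamma> (f x) (g x) x) (at x)"
    and "(g' has_real_derivative gp_force \<epsilon> \<gamma> (g x) (f x) x) (at x)"
    and "square_integrable f" "square_integrable f'" "square_integrable g" "square_integrable g'"
  using assms by (auto simp: gp_pair_def H1_classical_def)

lemma gp_pair_swap: "gp_pair \<epsilon> \<gamma> f f' g g' \<Longrightarrow> gp_pair \<epsilon> \<gamma> g g' f f'"
  by (auto simp: gp_pair_def)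

text \<open>The system is even in \<open>x\<close>, so every result on a right half-line transfers
  to the left.\<close>

lemma gp_pair_reflect:
  assumes "gp_pair \<epsilon> \<gamma> f f' g g'"
  shows "gp_pair \<epsilon> \<gamma> (\<lambda>x. f (- x)) (\<lambda>x. - f' (- x)) (\<lambda>x. g (- x)) (\<lambda>x. - g' (- x))"
proof -
  have "((\<lambda>x. - h (- x)) has_real_derivative h' (- x)) (at x)"
    if "\<And>x. (h has_real_derivative h' x) (at x)" for h h' :: "real \<Rightarrow> real" and x
    using that[of "- x"] by (auto simp: DERIV_mirror dest: DERIV_minus)
  from this[OF gp_pairD(5)[OF assms]] this[OF gp_pairD(6)[OF assms]]
  have "((\<lambda>x. - f' (- x)) has_real_derivative gp_force \<epsilon> \<gamma> (f (- x)) (g (- x)) x) (at x)"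
    "((\<lambda>x. - g' (- x)) has_real_derivative gp_force \<epsilon> \<gamma> (g (- x)) (f (- x)) x) (at x)" for x
    by (simp_all add: gp_force_def)
  then show ?thesis
    using gp_pairD(1,2)[OF assms] by (simp add: gp_pair_def H1_classical_reflect)
qed

text \<open>
  The rotation by 45 degrees exchanges symmetric and uncoupled states; the factor \<open>a\<close> normalises
  the self-interaction to 1 again.
\<close>

lemma gp_pair_rotate:
  assumes "gp_pair \<epsilon> \<gamma> f f' g g'" "0 < \<gamma>" and a: "a = sqrt (1 + \<gamma>) / 2"
  shows "gp_pair \<epsilon> ((3 - \<gamma>) / (1 + \<gamma>)) (\<lambda>x. a * f x + a * g x) (\<lambda>x. a * f' x + a * g' x)
    (\<lambda>x. a * f x + (- a) * g x) (\<lambda>x. a * f' x + (- a) * g' x)"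
proof -
  note d = gp_pairD[OF assms(1)]
  have a2: "a * a = (1 + \<gamma>) / 4" using assms(2) by (simp add: a)
  have F1: "a * gp_force \<epsilon> \<gamma> u v x + a * gp_force \<epsilon> \<gamma> v u x
      = gp_force \<epsilon> ((3 - \<gamma>) / (1 + \<gamma>)) (a * u + a * v) (a * u + (- a) * v) x"
    and F2: "a * gp_force \<epsilon> \<gamma> u v x + (- a) * gp_force \<epsilon> \<gamma> v u x
      = gp_force \<epsilon> ((3 - \<gamma>) / (1 + \<gamma>)) (a * u + (- a) * v) (a * u + a * v) x" for u v x
  proof -
    have s: "(a * u + a * v)\<^sup>2 = (1 + \<gamma>) / 4 * (u + v)\<^sup>2" "(a * u + (- a) * v)\<^sup>2 = (1 + \<gamma>) / 4 * (u - v)\<^sup>2"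
      unfolding a2[symmetric] by (simp_all add: power2_eq_square algebra_simps)
    have q: "(3 - \<gamma>) / (1 + \<gamma>) * ((1 + \<gamma>) / 4 * z) = (3 - \<gamma>) / 4 * z" for z
      using assms(2) by simp
    show "a * gp_force \<epsilon> \<gamma> u v x + a * gp_force \<epsilon> \<gamma> v u x
      = gp_force \<epsilon> ((3 - \<gamma>) / (1 + \<gamma>)) (a * u + a * v) (a * u + (- a) * v) x"
      "a * gp_force \<epsilon> \<gamma> u v x + (- a) * gp_force \<epsilon> \<gamma> v u x
      = gp_force \<epsilon> ((3 - \<gamma>) / (1 + \<gamma>)) (a * u + (- a) * v) (a * u + a * v) x"
      unfolding gp_force_def s q
      by (cases "\<epsilon> = 0"; simp add: field_simps; simp add: power2_eq_square power3_eq_cube algebra_simps)+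
  qed
  show ?thesis
    unfolding gp_pair_def F1[symmetric] F2[symmetric]
    using d by (intro conjI allI H1_classical_combination) (auto intro!: derivative_eq_intros)
qed

section \<open>The Wronskian of a pair with dominating first component\<close>

locale positive_pair =
  fixes \<epsilon> \<gamma> :: real and f f' g g' :: "real \<Rightarrow> real"
  assumes pair: "gp_pair \<epsilon> \<gamma> f f' g g'"
    and \<epsilon>: "0 < \<epsilon>" and \<gamma>: "0 < \<gamma>"
    and pos: "0 < f x" and dominated: "\<bar>g x\<bar> \<le> f x"
begin

lemmas d = gp_pairD[OF pair]

definition W where "W x = f x * g' x - g x * f' x"

definition Wd where "Wd x = (\<gamma> - 1) / \<epsilon>\<^sup>2 * (f x * g x * ((f x)\<^sup>2 - (g x)\<^sup>2))"

lemma DERIV_W: "(W has_real_derivative Wd x) (at x)"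
proof -
  have "(W has_real_derivative f x * gp_force \<epsilon> \<gamma> (g x) (f x) x + f' x * g' x
      - (g x * gp_force \<epsilon> \<gamma> (f x) (g x) x + g' x * f' x)) (at x)"
    unfolding W_def[abs_def] by (auto intro!: derivative_eq_intros d)
  moreover have "f x * gp_force \<epsilon> \<gamma> (g x) (f x) x + f' x * g' x
      - (g x * gp_force \<epsilon> \<gamma> (f x) (g x) x + g' x * f' x) = Wd x"
    using \<epsilon> by (simp add: gp_force_def Wd_def field_simps power2_eq_square)
  ultimately show ?thesis by simp
qed

lemma integrable_W: "integrable lborel W"
  unfolding W_def[abs_def]
  by (intro Bochner_Integration.integrable_diff integrable_mult_square_integrable d)

lemma exists_zero:
  assumes "\<gamma> \<noteq> 1" and strict: "\<bar>g 0\<bar> < f 0"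
  obtains z where "g z = 0"
proof (rule ccontr)
  assume "\<not> thesis"
  then have nz: "g x \<noteq> 0" for x using that by auto
  have cont: "continuous_on UNIV g" using d(4) DERIV_continuous_on by blast
  have sq: "(g x)\<^sup>2 \<le> (f x)\<^sup>2" for x
    using dominated[of x] pos[of x] by (auto simp: abs_le_square_iff[symmetric])
  have sign: "(\<forall>x. 0 < g x) \<or> (\<forall>x. g x < 0)"
  proof (rule ccontr)
    assume "\<not> ?thesis"
    then obtain x y where xy: "g x < 0" "g y > 0" using nz by (metis linorder_neqE)
    have "\<exists>z. g z = 0"
    proof (cases "x \<le> y")
      case True
      then show ?thesis
        using IVT'[of g x 0 y] xy cont by (auto intro: continuous_on_subset)
    next
      case False
      then show ?thesis
        using IVT2'[of g x 0 y] xy cont by (auto intro: continuous_on_subset)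
    qed
    then show False using nz by blast
  qed
  \<comment> \<open>The sign of \<open>Wd\<close> is that of \<open>(\<gamma> - 1) * g x\<close>
    wherever \<open>f\<^sup>2 > g\<^sup>2\<close>, so \<open>s\<close> is
    \<open>\<gamma> - 1\<close> times the constant sign of \<open>g\<close>.\<close>
  obtain s :: real where s: "s \<noteq> 0" "\<And>x. 0 \<le> s * Wd x"
  proof -
    have "\<exists>t. t \<noteq> 0 \<and> (\<forall>x. 0 \<le> t * g x)"
      using sign by (elim disjE; intro exI[of _ 1] exI[of _ "-1"]) (auto intro: less_imp_le)
    then obtain t where t: "t \<noteq> 0" "\<And>x. 0 \<le> t * g x" by blast
    have "0 \<le> (t * (\<gamma> - 1)) * Wd x" for x
    proof -
      have "(t * (\<gamma> - 1)) * Wd x = ((\<gamma> - 1)\<^sup>2 / \<epsilon>\<^sup>2) * (f x * (t * g x) * ((f x)\<^sup>2 - (g x)\<^sup>2))"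
        by (simp add: Wd_def power2_eq_square)
      also have "\<dots> \<ge> 0" using t(2)[of x] pos[of x] sq[of x] by simp
      finally show ?thesis .
    qed
    then show thesis using that[of "t * (\<gamma> - 1)"] t(1) \<open>\<gamma> \<noteq> 1\<close> by simp
  qed
  have "s * W x = 0" for x
    by (rule nondecreasing_integrable_zero[of "\<lambda>x. s * W x" "\<lambda>x. s * Wd x"])
      (use integrable_W s DERIV_W in \<open>auto intro!: DERIV_cmult\<close>)
  then have "W = (\<lambda>x. 0)" using s(1) by auto
  \<comment> \<open>A vanishing Wronskian has vanishing derivative, yet at the origin no factor of
    \<open>Wd\<close> is zero, thanks to the strict inequality there.\<close>
  then have "Wd 0 = 0" using DERIV_W[of 0] DERIV_unique[of W "Wd 0" 0 0] by simp
  moreover have "(g 0)\<^sup>2 < (f 0)\<^sup>2" using strict by (metis abs_le_square_iff abs_of_pos not_le pos)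
  ultimately show False using nz[of 0] pos[of 0] \<open>\<gamma> \<noteq> 1\<close> \<epsilon> by (simp add: Wd_def)
qed

text \<open>Beyond 1 the potential is nonnegative, so the positive function \<open>f\<close> is
  convex. A positive slope would keep \<open>f\<close> above a positive constant.\<close>

lemma f'_nonpos:
  assumes "1 \<le> x"
  shows "f' x \<le> 0"
proof (rule ccontr)
  assume "\<not> f' x \<le> 0"
  have f: "f x \<le> f y" if "x \<le> y" for y
  proof -
    have "- f y \<le> - f x"
    proof (rule trapped_right(1)[of x "\<lambda>x. - f x" "\<lambda>_. 1" "\<lambda>x. - f' x" "\<lambda>y. - gp_force \<epsilon> \<gamma> (f y) (g y) y"])
      show "- gp_force \<epsilon> \<gamma> (f y) (g y) y \<le> 0" if "x \<le> y" for y
      proof -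
        have "1 \<le> y\<^sup>2" using that assms by (simp add: one_le_power)
        then show ?thesis using \<epsilon> \<gamma> pos[of y] unfolding gp_force_def
          by (intro iffD2[OF neg_le_0_iff_le] mult_nonneg_nonneg divide_nonneg_nonneg add_nonneg_nonneg) auto
      qed
    qed (use d pos \<open>\<not> f' x \<le> 0\<close> that in \<open>auto intro!: derivative_eq_intros\<close>)
    then show ?thesis by simp
  qed
  have "integrable lborel (\<lambda>x. (f x)\<^sup>2)" using d by (simp add: square_integrable_def)
  then show False
  proof (rule not_integrable_if_bounded_below_right[of _ "(f x)\<^sup>2" x])
    show "0 < (f x)\<^sup>2" using pos[of x] by simp
    show "(f x)\<^sup>2 \<le> (f y)\<^sup>2" if "x \<le> y" for y using f[OF that] pos[of x] by (simp add: power_mono)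
  qed
qed

section \<open>Variation of the quotient \<open>g / f\<close>\<close>

lemma q_DERIV: "((\<lambda>x. g x / f x) has_real_derivative W x / (f x)\<^sup>2) (at x)"
  using pos[of x] by (auto intro!: derivative_eq_intros d simp: W_def power2_eq_square field_simps)

text \<open>
  On \<open>x \<ge> 2\<close> one has \<open>Z' \<le> - f\<^sup>4\<close>, so \<open>Z\<close> dominates the tail integral of \<open>f\<^sup>4\<close>, while
  \<open>Z / f\<^sup>2\<close> is up to a constant the derivative of \<open>- f\<^sup>2\<close>.
\<close>

definition Z where "Z x = - (\<epsilon>\<^sup>2 / 3) * ((f x)^3 * f' x)"

definition Zd where "Zd x = - (\<epsilon>\<^sup>2 / 3) * (3 * (f x)\<^sup>2 * (f' x)\<^sup>2 + (f x)^3 * gp_force \<epsilon> \<gamma> (f x) (g x) x)"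

lemma DERIV_Z: "(Z has_real_derivative Zd x) (at x)"
  unfolding Z_def[abs_def] Zd_def
  by (auto intro!: derivative_eq_intros d simp: power2_eq_square power3_eq_cube algebra_simps)

text \<open>For \<open>x \<ge> 2\<close> the potential \<open>x\<^sup>2 - 1\<close> is at least 3,
  which the factor \<open>\<epsilon>\<^sup>2 / 3\<close> in \<open>Z\<close> turns into the
  coefficient 1.\<close>

lemma Zd_le:
  assumes "2 \<le> x"
  shows "Zd x \<le> - ((f x)^4)"
proof -
  have "4 \<le> x\<^sup>2" using assms power_mono[of 2 x 2] by simp
  then have "3 / \<epsilon>\<^sup>2 \<le> (x\<^sup>2 - 1 + (f x)\<^sup>2 + \<gamma> * (g x)\<^sup>2) / \<epsilon>\<^sup>2"
    using \<epsilon> \<gamma> by (intro divide_right_mono) (auto intro!: add_increasing2)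
  then have "3 / \<epsilon>\<^sup>2 * f x \<le> gp_force \<epsilon> \<gamma> (f x) (g x) x"
    unfolding gp_force_def using pos[of x] by (intro mult_right_mono) auto
  then have "(f x)^3 * (3 / \<epsilon>\<^sup>2 * f x) \<le> (f x)^3 * gp_force \<epsilon> \<gamma> (f x) (g x) x"
    using pos[of x] by (intro mult_left_mono) auto
  also have "\<dots> \<le> 3 * (f x)\<^sup>2 * (f' x)\<^sup>2 + (f x)^3 * gp_force \<epsilon> \<gamma> (f x) (g x) x" by simp
  finally have "(\<epsilon>\<^sup>2 / 3) * ((f x)^3 * (3 / \<epsilon>\<^sup>2 * f x)) \<le> (\<epsilon>\<^sup>2 / 3) * (3 * (f x)\<^sup>2 * (f' x)\<^sup>2 + (f x)^3 * gp_force \<epsilon> \<gamma> (f x) (g x) x)"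
    by (intro mult_left_mono) auto
  moreover have "(\<epsilon>\<^sup>2 / 3) * ((f x)^3 * (3 / \<epsilon>\<^sup>2 * f x)) = (f x)^4"
    using \<epsilon> by (simp add: field_simps power4_eq_xxxx power3_eq_cube)
  ultimately show ?thesis by (simp add: Zd_def)
qed


text \<open>Two factors of \<open>f\<close> are absorbed by \<open>K\<^sup>2\<close>, leaving the
  product of the square integrable functions \<open>f\<close> and \<open>f'\<close>.\<close>

lemma integrable_Z:
  assumes "\<And>x. f x \<le> K"
  shows "integrable lborel Z"
proof (rule Bochner_Integration.integrable_bound)
  show "integrable lborel (\<lambda>x. (\<epsilon>\<^sup>2 / 3 * K\<^sup>2) * (f x * f' x))"
    by (intro integrable_mult_right integrable_mult_square_integrable d)
  have [measurable]: "f \<in> borel_measurable borel" "f' \<in> borel_measurable borel"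
    using d by (auto simp: square_integrable_def)
  show "Z \<in> borel_measurable lborel" unfolding Z_def[abs_def] by measurable
  show "AE x in lborel. norm (Z x) \<le> norm (\<epsilon>\<^sup>2 / 3 * K\<^sup>2 * (f x * f' x))"
  proof (rule AE_I2)
    fix x
    have "norm (Z x) = \<epsilon>\<^sup>2 / 3 * (f x)\<^sup>2 * \<bar>f x * f' x\<bar>"
      using pos[of x] by (simp add: Z_def abs_mult power2_eq_square power3_eq_cube)
    also have "\<dots> \<le> \<epsilon>\<^sup>2 / 3 * K\<^sup>2 * \<bar>f x * f' x\<bar>"
      using pos[of x] assms[of x] by (intro mult_right_mono mult_left_mono power_mono) auto
    also have "\<dots> = norm (\<epsilon>\<^sup>2 / 3 * K\<^sup>2 * (f x * f' x))"
      by (simp add: abs_mult)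
    finally show "norm (Z x) \<le> norm (\<epsilon>\<^sup>2 / 3 * K\<^sup>2 * (f x * f' x))" .
  qed
qed

definition \<kappa> where "\<kappa> = \<bar>\<gamma> - 1\<bar> / \<epsilon>\<^sup>2"

lemma \<kappa>_nonneg: "0 \<le> \<kappa>" by (simp add: \<kappa>_def)

lemma Wd_bound:
  assumes M: "\<bar>g x\<bar> \<le> M * f x"
  shows "\<bar>Wd x\<bar> \<le> \<kappa> * M * (f x)^4"
proof -
  have "(g x)\<^sup>2 \<le> (f x)\<^sup>2"
    using dominated[of x] pos[of x] by (auto simp: abs_le_square_iff[symmetric])
  then have "\<bar>(f x)\<^sup>2 - (g x)\<^sup>2\<bar> \<le> (f x)\<^sup>2" by simp
  have "\<bar>Wd x\<bar> = \<kappa> * (f x * (\<bar>g x\<bar> * \<bar>(f x)\<^sup>2 - (g x)\<^sup>2\<bar>))"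
    using pos[of x] by (simp add: Wd_def \<kappa>_def abs_mult)
  also have "\<dots> \<le> \<kappa> * (f x * ((M * f x) * (f x)\<^sup>2))"
    using pos[of x] \<kappa>_nonneg M \<open>\<bar>(f x)\<^sup>2 - (g x)\<^sup>2\<bar> \<le> (f x)\<^sup>2\<close>
    by (intro mult_left_mono mult_mono) (auto intro: order_trans[OF abs_ge_zero])
  also have "\<dots> = \<kappa> * M * (f x)^4" by (simp add: power4_eq_xxxx power2_eq_square)
  finally show ?thesis .
qed

text \<open>The derivative of \<open>W\<close> is at most \<open>\<kappa> * M * f^4\<close> in size,
  hence at most \<open>- \<kappa> * M * Zd\<close>. So both \<open>\<kappa> * M * Z + W\<close> and
  \<open>\<kappa> * M * Z - W\<close> are nonincreasing and integrable, hence nonnegative.\<close>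

lemma W_tail_bound:
  assumes K: "\<And>x. f x \<le> K" and M: "\<And>x. \<bar>g x\<bar> \<le> M * f x" and x: "2 \<le> x"
  shows "\<bar>W x\<bar> \<le> \<kappa> * M * Z x"
proof -
  have "0 \<le> M * f 0" using M[of 0] by (meson abs_ge_zero order_trans)
  then have M0: "0 \<le> M" using pos[of 0] by (simp add: zero_le_mult_iff)
  have "0 \<le> \<kappa> * M * Z x + s * W x" if s: "s = 1 \<or> s = -1" for s
  proof (rule nonincreasing_integrable_nonneg[OF _ _ _ x])
    show "integrable lborel (\<lambda>x. \<kappa> * M * Z x + s * W x)"
      using integrable_Z[OF K] integrable_W by simp
    fix y :: real assume y: "2 \<le> y"
    show "((\<lambda>x. \<kappa> * M * Z x + s * W x) has_real_derivative \<kappa> * M * Zd y + s * Wd y) (at y)"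
      by (intro DERIV_add DERIV_cmult DERIV_Z DERIV_W)
    have "\<kappa> * M * Zd y \<le> \<kappa> * M * - ((f y)^4)"
      using Zd_le[OF y] \<kappa>_nonneg M0 by (intro mult_left_mono) auto
    moreover have "s * Wd y \<le> \<kappa> * M * (f y)^4"
      using Wd_bound[OF M, of y] s by auto
    ultimately show "\<kappa> * M * Zd y + s * Wd y \<le> 0" by simp
  qed
  from this[of 1] this[of "-1"] show ?thesis by auto
qed

text \<open>Dividing by \<open>f\<^sup>2\<close> is harmless although \<open>f\<close> decays:
  \<open>\<kappa> * M * Z / f\<^sup>2\<close> is exactly minus the derivative of
  \<open>C * f\<^sup>2\<close>. So adding or subtracting the quotient leaves
  \<open>C * f\<^sup>2\<close> nonincreasing, and the total variation is controlled by
  \<open>C * K\<^sup>2\<close>.\<close>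

lemma quotient_tail_bound:
  assumes K: "\<And>x. f x \<le> K" and M: "\<And>x. \<bar>g x\<bar> \<le> M * f x" and x: "2 \<le> x"
  shows "\<bar>g x / f x - g 2 / f 2\<bar> \<le> \<kappa> * M * (\<epsilon>\<^sup>2 * K\<^sup>2)"
proof -
  have "0 \<le> M * f 0" using M[of 0] by (meson abs_ge_zero order_trans)
  then have M0: "0 \<le> M" using pos[of 0] by (simp add: zero_le_mult_iff)
  define C where "C = \<kappa> * M * (\<epsilon>\<^sup>2 / 6)"
  have C: "0 \<le> C" using \<kappa>_nonneg M0 by (simp add: C_def)
  have "C * (f x)\<^sup>2 + s * (g x / f x) \<le> C * (f 2)\<^sup>2 + s * (g 2 / f 2)" if s: "s = 1 \<or> s = -1" for s
  proof (rule DERIV_nonpos_imp_nonincreasing[OF x])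
    fix y assume y: "2 \<le> y" "y \<le> x"
    have deriv: "((\<lambda>x. C * (f x)\<^sup>2 + s * (g x / f x)) has_real_derivative
        C * (2 * f y * f' y) + s * (W y / (f y)\<^sup>2)) (at y)"
    proof (intro DERIV_add DERIV_cmult q_DERIV)
      show "((\<lambda>x. (f x)\<^sup>2) has_real_derivative 2 * f y * f' y) (at y)"
        by (auto intro!: derivative_eq_intros d)
    qed
    have "\<bar>W y / (f y)\<^sup>2\<bar> \<le> - (C * (2 * f y * f' y))"
      using W_tail_bound[OF K M y(1)] pos[of y]
      by (simp add: C_def Z_def abs_divide divide_le_eq power2_eq_square power3_eq_cube algebra_simps)
    moreover have "s * (W y / (f y)\<^sup>2) \<le> \<bar>W y / (f y)\<^sup>2\<bar>" using s by (auto simp del: abs_divide)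
    ultimately have "C * (2 * f y * f' y) + s * (W y / (f y)\<^sup>2) \<le> 0" by linarith
    with deriv show "\<exists>D. ((\<lambda>x. C * (f x)\<^sup>2 + s * (g x / f x)) has_real_derivative D) (at y) \<and> D \<le> 0"
      by blast
  qed
  from this[of 1] this[of "-1"]
  have "\<bar>g x / f x - g 2 / f 2\<bar> \<le> C * (f 2)\<^sup>2 - C * (f x)\<^sup>2" by auto
  also have "\<dots> \<le> C * K\<^sup>2"
    using C K[of 2] pos[of 2] by (auto intro!: mult_left_mono power_mono add_increasing2 simp: diff_le_eq)
  also have "\<dots> \<le> \<kappa> * M * (\<epsilon>\<^sup>2 * K\<^sup>2)"
    using \<kappa>_nonneg M0 by (simp add: C_def mult_left_mono)
  finally show ?thesis .
qed

text \<open>The bound on \<open>Z 2\<close> needs one on the slope at 2. Since \<open>f\<close> is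
  convex beyond 1, \<open>f' 2\<close> is at least the mean slope on [1, 2], which is at least
  \<open>- K\<close>.\<close>

lemma W_2_bound:
  assumes K: "\<And>x. f x \<le> K" and M: "\<And>x. \<bar>g x\<bar> \<le> M * f x"
  shows "\<bar>W 2\<bar> \<le> \<kappa> * M * (\<epsilon>\<^sup>2 * K^4)"
proof -
  have "0 \<le> M * f 0" using M[of 0] by (meson abs_ge_zero order_trans)
  then have M0: "0 \<le> M" using pos[of 0] by (simp add: zero_le_mult_iff)
  have K0: "0 \<le> K" using K[of 0] pos[of 0] by simp
  from MVT2[of 1 2 f f'] d(3) obtain t where t: "1 < t" "t < 2" "f 2 - f 1 = f' t" by auto
  have "f' t \<le> f' 2"
  proof (rule DERIV_nonneg_imp_nondecreasing[where f = f'])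
    fix y assume "t \<le> y"
    then have "1 \<le> y\<^sup>2" using t by (simp add: one_le_power)
    then have "0 \<le> gp_force \<epsilon> \<gamma> (f y) (g y) y"
      using \<epsilon> \<gamma> pos[of y] unfolding gp_force_def
      by (intro mult_nonneg_nonneg divide_nonneg_nonneg add_nonneg_nonneg) auto
    then show "\<exists>D. (f' has_real_derivative D) (at y) \<and> 0 \<le> D" using d(5) by blast
  qed (use t in simp)
  then have "- f' 2 \<le> K" using t(3) pos[of 2] K[of 1] by simp
  then have "(f 2)^3 * - f' 2 \<le> K^3 * K"
    using pos[of 2] K[of 2] K0 f'_nonpos[of 2] by (intro mult_mono power_mono) auto
  then have "(\<epsilon>\<^sup>2 / 3) * ((f 2)^3 * - f' 2) \<le> (\<epsilon>\<^sup>2 / 3) * (K^3 * K)" by (intro mult_left_mono) auto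
  also have "\<dots> \<le> \<epsilon>\<^sup>2 * K^4" using K0 by (simp add: power4_eq_xxxx power3_eq_cube)
  finally have "Z 2 \<le> \<epsilon>\<^sup>2 * K^4" by (simp add: Z_def)
  then have "\<kappa> * M * Z 2 \<le> \<kappa> * M * (\<epsilon>\<^sup>2 * K^4)" using \<kappa>_nonneg M0 by (intro mult_left_mono) auto
  then show ?thesis using W_tail_bound[OF K M, of 2] by simp
qed

text \<open>On the core the mean value theorem is used twice: first from \<open>W 2\<close> to
  \<open>W\<close>, then, dividing by \<open>f\<^sup>2 \<ge> c\<^sup>2\<close>, for the quotient
  itself.\<close>

lemma quotient_core_bound:
  assumes K: "\<And>x. f x \<le> K" and M: "\<And>x. \<bar>g x\<bar> \<le> M * f x"
    and c: "0 < c" "\<And>x. x \<in> {-2..2} \<Longrightarrow> c \<le> f x" and x: "x \<in> {-2..2}"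
  shows "\<bar>g x / f x - g 2 / f 2\<bar> \<le> \<kappa> * M * (4 * (\<epsilon>\<^sup>2 + 4) * K^4 / c\<^sup>2)"
proof -
  have "0 \<le> M * f 0" using M[of 0] by (meson abs_ge_zero order_trans)
  then have M0: "0 \<le> M" using pos[of 0] by (simp add: zero_le_mult_iff)
  have K0: "0 \<le> K" using K[of 0] pos[of 0] by simp
  \<comment> \<open>The factor 4 is the length of the core interval.\<close>
  have MVT: "\<bar>F 2 - F y\<bar> \<le> 4 * B"
    if F: "\<And>x. (F has_real_derivative F' x) (at x)" and B: "\<And>x. x \<in> {-2..2} \<Longrightarrow> \<bar>F' x\<bar> \<le> B"
      and y: "y \<in> {-2..2}" for F F' :: "real \<Rightarrow> real" and B y
  proof (cases "y = 2")
    case True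
    then show ?thesis using B[of 0] by auto
  next
    case False
    then have "y < 2" using y by auto
    from MVT2[OF this F] obtain z where z: "y < z" "z < 2" "F 2 - F y = (2 - y) * F' z" by blast
    then have "\<bar>F 2 - F y\<bar> = (2 - y) * \<bar>F' z\<bar>" using y by (simp add: abs_mult)
    also have "\<dots> \<le> 4 * B" using y z B[of z] by (intro mult_mono) auto
    finally show ?thesis .
  qed
  have W: "\<bar>W y\<bar> \<le> \<kappa> * M * ((\<epsilon>\<^sup>2 + 4) * K^4)" if y: "y \<in> {-2..2}" for y
  proof -
    have "\<bar>Wd z\<bar> \<le> \<kappa> * M * K^4" for z
      using Wd_bound[OF M, of z] K[of z] pos[of z] \<kappa>_nonneg M0
      by (elim order_trans) (intro mult_left_mono power_mono; simp)
    from MVT[OF DERIV_W this y] W_2_bound[OF K M] show ?thesis by (simp add: algebra_simps abs_le_iff)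
  qed
  have "\<bar>W y / (f y)\<^sup>2\<bar> \<le> \<kappa> * M * ((\<epsilon>\<^sup>2 + 4) * K^4) / c\<^sup>2" if y: "y \<in> {-2..2}" for y
    using W[OF y] c(1) c(2)[OF y] K0 \<kappa>_nonneg M0 unfolding abs_divide abs_power2
    by (intro frac_le power_mono) auto
  from MVT[OF q_DERIV this x] show ?thesis by (simp add: abs_minus_commute algebra_simps)
qed

end

section \<open>Contraction for the quotient\<close>

lemma positive_pair_reflect:
  assumes "positive_pair \<epsilon> \<gamma> f f' g g'"
  shows "positive_pair \<epsilon> \<gamma> (\<lambda>x. f (- x)) (\<lambda>x. - f' (- x)) (\<lambda>x. g (- x)) (\<lambda>x. - g' (- x))"
  using assms by (simp add: positive_pair_def gp_pair_reflect)

text \<open>The first summand is the cost of a tail, the second that of the core. On the left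
  half-line both occur, since the base point of the comparison is always 2.\<close>

definition contraction_bound :: "real \<Rightarrow> real \<Rightarrow> real \<Rightarrow> real" where
  "contraction_bound \<epsilon> c K = \<epsilon>\<^sup>2 * K\<^sup>2 + 4 * (\<epsilon>\<^sup>2 + 4) * K^4 / c\<^sup>2"

context positive_pair
begin

lemma quotient_bound:
  assumes K: "\<And>x. f x \<le> K" and M: "\<And>x. \<bar>g x\<bar> \<le> M * f x"
    and c: "0 < c" "\<And>x. x \<in> {-2..2} \<Longrightarrow> c \<le> f x"
  shows "\<bar>g x / f x - g 2 / f 2\<bar> \<le> \<kappa> * M * contraction_bound \<epsilon> c K"
proof -
  have "0 \<le> M * f 0" using M[of 0] by (meson abs_ge_zero order_trans)
  then have M0: "0 \<le> M" using pos[of 0] by (simp add: zero_le_mult_iff)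
  have K0: "0 \<le> K" using K[of 0] pos[of 0] by simp
  \<comment> \<open>The reflected pair gives the tail estimate to the left of \<open>-2\<close>,
    with base point \<open>-2\<close>.\<close>
  interpret R: positive_pair \<epsilon> \<gamma> "\<lambda>x. f (- x)" "\<lambda>x. - f' (- x)" "\<lambda>x. g (- x)" "\<lambda>x. - g' (- x)"
    by (intro positive_pair_reflect positive_pair_axioms)
  have nn: "0 \<le> \<kappa> * M * (\<epsilon>\<^sup>2 * K\<^sup>2)" "0 \<le> \<kappa> * M * (4 * (\<epsilon>\<^sup>2 + 4) * K^4 / c\<^sup>2)"
    using \<kappa>_nonneg M0 K0 by (auto intro!: mult_nonneg_nonneg divide_nonneg_nonneg add_nonneg_nonneg)
  note core = quotient_core_bound[OF K M c]
  consider "x > 2" | "x < -2" | "x \<in> {-2..2}" by fastforce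
  then show ?thesis
  proof cases
    case 1
    then show ?thesis using quotient_tail_bound[OF K M, of x] nn
      by (simp add: contraction_bound_def distrib_left)
  next
    case 2
    then have "\<bar>g x / f x - g (- 2) / f (- 2)\<bar> \<le> \<kappa> * M * (\<epsilon>\<^sup>2 * K\<^sup>2)"
      using R.quotient_tail_bound[of K M "- x"] K M unfolding R.\<kappa>_def \<kappa>_def by simp
    then show ?thesis using core[of "-2"] by (simp add: contraction_bound_def distrib_left)
  next
    case 3
    then show ?thesis using core[of x] nn by (simp add: contraction_bound_def distrib_left)
  qed
qed

lemma minor_component_zero:
  assumes K: "\<And>x. f x \<le> K" and c: "0 < c" "\<And>x. x \<in> {-2..2} \<Longrightarrow> c \<le> f x"
    and strict: "\<bar>g 0\<bar> < f 0" and "\<gamma> \<noteq> 1"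
    and small: "4 * \<bar>\<gamma> - 1\<bar> * contraction_bound \<epsilon> c K \<le> \<epsilon>\<^sup>2"
  shows "g x = 0"
proof -
  obtain z where z: "g z = 0" using exists_zero[OF \<open>\<gamma> \<noteq> 1\<close> strict] .
  \<comment> \<open>A quarter suffices because the quotient at \<open>y\<close> and its zero at
    \<open>z\<close> are each compared with the base point 2, which doubles the bound.\<close>
  have \<kappa>: "\<kappa> * contraction_bound \<epsilon> c K \<le> 1 / 4"
    using small \<epsilon> by (simp add: \<kappa>_def field_simps)
  have step: "\<bar>g y\<bar> \<le> (M / 2) * f y" if M: "\<And>x. \<bar>g x\<bar> \<le> M * f x" for M y
  proof -
    have "0 \<le> M * f 0" using M[of 0] by (meson abs_ge_zero order_trans)
    then have M0: "0 \<le> M" using pos[of 0] by (simp add: zero_le_mult_iff)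
    have "\<kappa> * M * contraction_bound \<epsilon> c K = M * (\<kappa> * contraction_bound \<epsilon> c K)" by simp
    also have "\<dots> \<le> M * (1 / 4)" using \<kappa> M0 by (rule mult_left_mono)
    finally have "\<bar>g y / f y - g 2 / f 2\<bar> \<le> M * (1 / 4)" "\<bar>g z / f z - g 2 / f 2\<bar> \<le> M * (1 / 4)"
      using quotient_bound[OF K M c, of y] quotient_bound[OF K M c, of z] by linarith+
    moreover have "g z / f z = 0" using z by simp
    ultimately have "\<bar>g y / f y\<bar> \<le> M / 2" by linarith
    then show ?thesis using pos[of y] by (simp add: abs_divide divide_le_eq)
  qed
  \<comment> \<open>Domination is the starting bound \<open>M = 1\<close>, and each application of
    the contraction halves it.\<close>
  have "\<bar>g y\<bar> \<le> (1 / 2) ^ n * f y" for n y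
  proof (induction n arbitrary: y)
    case 0
    show ?case using dominated by simp
  next
    case (Suc n)
    show ?case using step[OF Suc, of y] by simp
  qed
  moreover have "(\<lambda>n. (1 / 2) ^ n * f x) \<longlonglongrightarrow> 0 * f x"
    by (intro tendsto_mult_right LIMSEQ_realpow_zero) auto
  ultimately have "\<bar>g x\<bar> \<le> 0" by (intro LIMSEQ_le_const) auto
  then show ?thesis by simp
qed

end


section \<open>Uniqueness of the positive scalar state\<close>

lemma positive_state_le:
  assumes f: "gp_pair \<epsilon> \<gamma> f f' (\<lambda>x. 0) (\<lambda>x. 0)" "\<And>x. 0 < f x"
    and e: "gp_pair \<epsilon> \<gamma> e e' (\<lambda>x. 0) (\<lambda>x. 0)" "\<And>x. 0 < e x"
    and "0 < \<epsilon>"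
  shows "f x \<le> e x"
proof -
  \<comment> \<open>Suppose \<open>f / e\<close> exceeds 1 at \<open>x\<close> and is not decreasing
    there. The Wronskian grows as long as \<open>f > e\<close>, which in turn keeps
    \<open>f / e\<close> growing, so \<open>trapped_right\<close> applies to
    \<open>1 - f / e\<close> and \<open>- W\<close>.\<close>
  have half: False
    if f: "gp_pair \<epsilon> \<gamma> f f' (\<lambda>x. 0) (\<lambda>x. 0)" "\<And>x. 0 < f x"
      and e: "gp_pair \<epsilon> \<gamma> e e' (\<lambda>x. 0) (\<lambda>x. 0)" "\<And>x. 0 < e x"
      and x: "e x < f x" "0 \<le> e x * f' x - f x * e' x" for f f' e e' x
  proof -
    note d = gp_pairD[OF f(1)] and k = gp_pairD[OF e(1)]
    define W where "W = (\<lambda>y. e y * f' y - f y * e' y)"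
    define Wd where "Wd = (\<lambda>y. e y * f y * ((f y)\<^sup>2 - (e y)\<^sup>2) / \<epsilon>\<^sup>2)"
    have W: "(W has_real_derivative Wd y) (at y)" for y
    proof -
      have "(W has_real_derivative e y * gp_force \<epsilon> \<gamma> (f y) 0 y + e' y * f' y
          - (f y * gp_force \<epsilon> \<gamma> (e y) 0 y + f' y * e' y)) (at y)"
        unfolding W_def by (auto intro!: derivative_eq_intros d k)
      moreover have "e y * gp_force \<epsilon> \<gamma> (f y) 0 y + e' y * f' y
          - (f y * gp_force \<epsilon> \<gamma> (e y) 0 y + f' y * e' y) = Wd y"
        using \<open>0 < \<epsilon>\<close> by (simp add: gp_force_def Wd_def field_simps power2_eq_square)
      ultimately show ?thesis by simp
    qed
    have int: "integrable lborel W"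
      unfolding W_def by (intro Bochner_Integration.integrable_diff integrable_mult_square_integrable d k)
    have r: "((\<lambda>y. 1 - f y / e y) has_real_derivative (1 / (e y)\<^sup>2) * - W y) (at y)" for y
      using e(2)[of y] by (auto intro!: derivative_eq_intros d k simp: W_def power2_eq_square field_simps)
    have Wd_pos: "0 < Wd y" if "1 - f y / e y < 0" for y
    proof -
      have "e y < f y" using that e(2)[of y] by (simp add: less_divide_eq)
      then have "(e y)\<^sup>2 < (f y)\<^sup>2" using e(2)[of y] by (simp add: power_strict_mono)
      then show ?thesis using f(2)[of y] e(2)[of y] \<open>0 < \<epsilon>\<close> by (simp add: Wd_def)
    qed
    have trap: "1 - f y / e y < 0" "W x \<le> W y" if "x \<le> y" for y
    proof -
      have *: "1 - f x / e x < 0" using x(1) e(2)[of x] by (simp add: less_divide_eq)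
      have "1 - f y / e y \<le> 1 - f x / e x" "- W y \<le> - W x"
        using trapped_right[of x "\<lambda>y. 1 - f y / e y" "\<lambda>y. 1 / (e y)\<^sup>2" "\<lambda>y. - W y" "\<lambda>y. - Wd y" y,
            OF r _ DERIV_minus[OF W] _ * _ that] x(2) Wd_pos
        by (auto simp: W_def intro: less_imp_le)
      then show "1 - f y / e y < 0" "W x \<le> W y" using * by auto
    qed
    have "W y < W z" if "x \<le> y" "y < z" for y z
      by (rule DERIV_pos_imp_increasing[OF that(2)]) (use W Wd_pos trap that in \<open>meson order_trans\<close>)
    \<comment> \<open>\<open>W x\<close> may be zero, so a positive lower bound is taken one unit
      further to the right.\<close>
    then have "W x < W (x + 1)" "\<And>z. x + 1 \<le> z \<Longrightarrow> W (x + 1) \<le> W z"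
      by (force simp: le_less)+
    moreover have "0 \<le> W x" using x(2) by (simp add: W_def)
    ultimately show False
      using not_integrable_if_bounded_below_right[OF int, of "W (x + 1)" "x + 1"] by auto
  qed
  show ?thesis
  proof (rule ccontr)
    assume "\<not> ?thesis"
    then have less: "e x < f x" by simp
    show False
    proof (cases "0 \<le> e x * f' x - f x * e' x")
      case True
      show ?thesis by (rule half[OF f e less True])
    next
      case False
      \<comment> \<open>Reflection reverses the sign of the Wronskian and so leads back to the case
        already excluded.\<close>
      have fr: "gp_pair \<epsilon> \<gamma> (\<lambda>x. f (- x)) (\<lambda>x. - f' (- x)) (\<lambda>x. 0) (\<lambda>x. 0)"
        and er: "gp_pair \<epsilon> \<gamma> (\<lambda>x. e (- x)) (\<lambda>x. - e' (- x)) (\<lambda>x. 0) (\<lambda>x. 0)"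
        using gp_pair_reflect[OF f(1)] gp_pair_reflect[OF e(1)] by simp_all
      show ?thesis
        by (rule half[OF fr f(2) er e(2), of "- x"]) (use False less in simp_all)
    qed
  qed
qed

lemma positive_state_unique:
  assumes "gp_pair \<epsilon> \<gamma> f f' (\<lambda>x. 0) (\<lambda>x. 0)" "\<And>x. 0 < f x"
    and "gp_pair \<epsilon> \<gamma> e e' (\<lambda>x. 0) (\<lambda>x. 0)" "\<And>x. 0 < e x" and "0 < \<epsilon>"
  shows "f = e"
  using positive_state_le[OF assms] positive_state_le[OF assms(3,4,1,2,5)] by (auto intro!: ext antisym)

section \<open>From the core interval to the whole line\<close>

lemma dominated_right:
  assumes pair: "gp_pair \<epsilon> \<gamma> f f' g g'" and "0 < \<epsilon>" "0 < \<gamma>" "\<gamma> < 3"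
    and core: "\<bar>g 2\<bar> < f 2" and x: "2 \<le> x"
  shows "\<bar>g x\<bar> \<le> f x"
proof -
  note d = gp_pairD[OF pair]
  \<comment> \<open>Domination amounts to both \<open>f + g\<close> and \<open>f - g\<close> being
    nonnegative; each is concave wherever it is negative.\<close>
  have "0 \<le> f y + s * g y" if s: "s = 1 \<or> s = -1" and y: "2 \<le> y" for s y
  proof (rule nonneg_right_tail[OF _ _ _ _ _ y])
    fix z
    show "((\<lambda>y. f y + s * g y) has_real_derivative f' z + s * g' z) (at z)"
      "((\<lambda>y. f' y + s * g' y) has_real_derivative
        gp_force \<epsilon> \<gamma> (f z) (g z) z + s * gp_force \<epsilon> \<gamma> (g z) (f z) z) (at z)"
      by (intro DERIV_add DERIV_cmult d)+
    show "integrable lborel (\<lambda>y. (f y + s * g y)\<^sup>2)"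
      using square_integrable_combination[OF d(7) d(9), of 1 s] by (simp add: square_integrable_def)
    show "0 \<le> f 2 + s * g 2" using core s by auto
    assume z: "2 \<le> z" and neg: "f z + s * g z < 0"
    \<comment> \<open>The cubic terms of the combined equation factor through
      \<open>f + s * g\<close>. In the remaining potential \<open>Q\<close> the cross term is
      absorbed by \<open>f\<^sup>2 + g\<^sup>2\<close>, as \<open>\<gamma>\<close> lies within
      distance 2 of 1.\<close>
    define Q where "Q = z\<^sup>2 - 1 + (f z)\<^sup>2 + (g z)\<^sup>2 - s * (1 - \<gamma>) * (f z * g z)"
    have s2: "s * s = 1" using s by auto
    have "gp_force \<epsilon> \<gamma> (f z) (g z) z + s * gp_force \<epsilon> \<gamma> (g z) (f z) z = (f z + s * g z) * (Q / \<epsilon>\<^sup>2)"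
      using s \<open>0 < \<epsilon>\<close> by (auto simp: gp_force_def Q_def field_simps power2_eq_square)
    moreover have "0 \<le> Q"
    proof -
      have "4 \<le> z\<^sup>2" using z power_mono[of 2 z 2] by simp
      have "\<bar>s * (1 - \<gamma>) * (f z * g z)\<bar> \<le> 2 * \<bar>f z * g z\<bar>"
        using s \<open>0 < \<gamma>\<close> \<open>\<gamma> < 3\<close> unfolding abs_mult by (intro mult_right_mono) auto
      also have "\<dots> \<le> (f z)\<^sup>2 + (g z)\<^sup>2"
        using sum_squares_bound[of "\<bar>f z\<bar>" "\<bar>g z\<bar>"] by (simp add: abs_mult)
      finally show ?thesis using \<open>4 \<le> z\<^sup>2\<close> by (simp add: Q_def)
    qed
    then have "(f z + s * g z) * (Q / \<epsilon>\<^sup>2) \<le> 0"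
      using neg by (intro mult_nonpos_nonneg) auto
    ultimately show "gp_force \<epsilon> \<gamma> (f z) (g z) z + s * gp_force \<epsilon> \<gamma> (g z) (f z) z \<le> 0"
      by simp
  qed
  from this[of 1 x] this[of "-1" x] x show ?thesis by auto
qed

text \<open>Domination yields only \<open>f \<ge> 0\<close>. Freezing \<open>f\<close> and
  \<open>g\<close> in the potential makes the equation of \<open>f\<close> linear with continuous
  coefficient, so \<open>pos_right_tail\<close> gives strict positivity.\<close>

lemma dominated_right_pos:
  assumes pair: "gp_pair \<epsilon> \<gamma> f f' g g'" and \<epsilon>: "0 < \<epsilon>" "0 < \<gamma>" "\<gamma> < 3"
    and core: "\<bar>g 2\<bar> < f 2" and x: "2 \<le> x"
  shows "0 < f x"
proof -
  note d = gp_pairD[OF pair]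
  have c: "continuous_on UNIV f" "continuous_on UNIV g"
    using DERIV_continuous_on d(3,4) by blast+
  show ?thesis
  proof (rule pos_right_tail[OF d(3) d(5)[unfolded gp_force_def] _ _ _ x])
    show "continuous_on UNIV (\<lambda>x. (x\<^sup>2 - 1 + (f x)\<^sup>2 + \<gamma> * (g x)\<^sup>2) / \<epsilon>\<^sup>2)"
      using \<epsilon> by (intro continuous_intros c) auto
    show "0 \<le> f y" if "2 \<le> y" for y using dominated_right[OF assms(1-5) that] by simp
  qed (use core in simp)
qed

lemma positive_pairI:
  assumes pair: "gp_pair \<epsilon> \<gamma> f f' g g'" and \<epsilon>: "0 < \<epsilon>" "0 < \<gamma>" "\<gamma> < 3"
    and core: "\<And>x. x \<in> {-2..2} \<Longrightarrow> \<bar>g x\<bar> < f x"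
  shows "positive_pair \<epsilon> \<gamma> f f' g g'"
proof
  fix x :: real
  note pair_r = gp_pair_reflect[OF pair]
  have c: "\<bar>g 2\<bar> < f 2" "\<bar>g (- 2)\<bar> < f (- 2)" using core[of 2] core[of "-2"] by auto
  consider "2 \<le> x" | "2 \<le> - x" | "x \<in> {-2..2}" by fastforce
  then have "0 < f x \<and> \<bar>g x\<bar> \<le> f x"
  proof cases
    case 1
    then show ?thesis using dominated_right[OF pair \<epsilon> c(1)] dominated_right_pos[OF pair \<epsilon> c(1)] by blast
  next
    case 2
    then show ?thesis
      using dominated_right[OF pair_r \<epsilon> c(2), of "- x"] dominated_right_pos[OF pair_r \<epsilon> c(2), of "- x"] by simp
  next
    case 3
    then show ?thesis using core[of x] by auto
  qed
  then show "0 < f x" "\<bar>g x\<bar> \<le> f x" by auto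
qed (use assms in auto)

lemma dominated_pair_is_uncoupled:
  assumes pair: "gp_pair \<epsilon> \<gamma> f f' g g'" and \<epsilon>: "0 < \<epsilon>" "0 < \<gamma>" "\<gamma> < 3" and "\<gamma> \<noteq> 1"
    and core: "0 < c" "\<And>x. x \<in> {-2..2} \<Longrightarrow> c + \<bar>g x\<bar> \<le> f x" and K: "\<And>x. f x \<le> K"
    and small: "4 * \<bar>\<gamma> - 1\<bar> * contraction_bound \<epsilon> c K \<le> \<epsilon>\<^sup>2"
    and e: "gp_pair \<epsilon> \<gamma> e e' (\<lambda>x. 0) (\<lambda>x. 0)" "\<And>x. 0 < e x"
  shows "g = (\<lambda>x. 0)" "f = e"
proof -
  have core': "\<bar>g x\<bar> < f x" "c \<le> f x" if "x \<in> {-2..2}" for x using core(1) core(2)[OF that] by auto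
  interpret positive_pair \<epsilon> \<gamma> f f' g g'
    by (rule positive_pairI) (use pair \<epsilon> core' in auto)
  have g0: "g x = 0" for x
    by (rule minor_component_zero[of K c]) (use K core core' small \<open>\<gamma> \<noteq> 1\<close> in auto)
  show g: "g = (\<lambda>x. 0)" using g0 by auto
  have "g' = (\<lambda>x. 0)"
  proof
    show "g' x = 0" for x
      using d(4)[of x] DERIV_unique[of "\<lambda>x. 0" "g' x" x 0] unfolding g by simp
  qed
  then show "f = e"
    using positive_state_unique[of \<epsilon> \<gamma> f f' e e'] pair e pos \<epsilon> g by simp
qed

section \<open>Continuation of the rotated family\<close>

lemma coupled_solution_imp_gp_pair:
  assumes "coupled_solution \<epsilon> \<gamma> (f, g)" "0 < \<epsilon>"
  shows "gp_pair \<epsilon> \<gamma> f (deriv f) g (deriv g)"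
proof -
  have *: "H1_classical u (deriv u) \<and> (\<forall>x. (deriv u has_real_derivative gp_force \<epsilon> \<gamma> (u x) (v x) x) (at x))"
    if u: "u \<in> H1" "twice_differentiable u" and eq: "\<And>x. - (\<epsilon>\<^sup>2) * deriv (deriv u) x + x\<^sup>2 * u x
             + ((u x)\<^sup>2 + \<gamma> * (v x)\<^sup>2 - 1) * u x = 0" for u v
  proof -
    have d: "(u has_real_derivative deriv u x) (at x)" "(deriv u has_real_derivative deriv (deriv u) x) (at x)" for x
      using u(2) by (auto simp: twice_differentiable_def differentiable_on_def DERIV_deriv_iff_real_differentiable)
    have "H1_classical u (deriv u)"
      using d(2) DERIV_continuous_on by (intro H1_classicalI u d) blast
    moreover have "deriv (deriv u) x = gp_force \<epsilon> \<gamma> (u x) (v x) x" for x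
      using eq[of x] \<open>0 < \<epsilon>\<close> by (simp add: gp_force_def field_simps)
    ultimately show ?thesis using d(2) by simp
  qed
  then show ?thesis
    using assms *[of f g] *[of g f]
    by (simp add: coupled_solution_def energy_space_def gp_pair_def add.commute)
qed

lemma gp_pair_imp_coupled_solution:
  assumes "gp_pair \<epsilon> \<gamma> f f' g g'" "f \<in> L21" "g \<in> L21" "0 < \<epsilon>"
  shows "coupled_solution \<epsilon> \<gamma> (f, g)"
proof -
  note d = gp_pairD[OF assms(1)]
  have [simp]: "deriv f = f'" "deriv g = g'" using d(3,4) by (auto intro!: DERIV_imp_deriv)
  have [simp]: "deriv f' x = gp_force \<epsilon> \<gamma> (f x) (g x) x" "deriv g' x = gp_force \<epsilon> \<gamma> (g x) (f x) x" for x
    using d(5,6) by (auto intro!: DERIV_imp_deriv)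
  have "twice_differentiable f" "twice_differentiable g"
    using d(3-6)
    by (simp_all add: twice_differentiable_def differentiable_on_def)
      (metis real_differentiable_def)+
  then show ?thesis
    using assms(2-4) H1_classical_imp_H1[OF d(1)] H1_classical_imp_H1[OF d(2)]
    by (auto simp: coupled_solution_def energy_space_def gp_force_def field_simps)
qed

text \<open>The coupling multiplies the vanishing component, so a single profile serves every
  \<open>\<gamma>\<close>.\<close>

lemma positive_ground_state_gp_pair:
  assumes "positive_ground_state \<epsilon> \<eta>" "0 < \<epsilon>"
  shows "gp_pair \<epsilon> \<gamma> \<eta> (deriv \<eta>) (\<lambda>x. 0) (\<lambda>x. 0)"
proof -
  have d: "(\<eta> has_real_derivative deriv \<eta> x) (at x)" "(deriv \<eta> has_real_derivative deriv (deriv \<eta>) x) (at x)" for x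
    using assms by (auto simp: positive_ground_state_def twice_differentiable_def differentiable_on_def
        DERIV_deriv_iff_real_differentiable)
  have "H1_classical \<eta> (deriv \<eta>)"
  proof (rule H1_classicalI[OF d(1)])
    show "continuous_on UNIV (deriv \<eta>)" using d(2) DERIV_continuous_on by blast
    show "\<eta> \<in> H1" using assms by (simp add: positive_ground_state_def)
  qed
  moreover have "deriv (deriv \<eta>) x = gp_force \<epsilon> \<gamma> (\<eta> x) 0 x" for x
  proof -
    have "\<epsilon>\<^sup>2 * deriv (deriv \<eta>) x + (1 - x\<^sup>2 - (\<eta> x)\<^sup>2) * \<eta> x = 0"
      using assms by (simp add: positive_ground_state_def)
    then show ?thesis using \<open>0 < \<epsilon>\<close> by (simp add: gp_force_def field_simps)
  qed
  ultimately show ?thesis using d(2) by (simp add: gp_pair_def H1_classical_zero) (simp add: gp_force_def)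
qed

text \<open>A zero component solves its equation trivially; otherwise its effective cubic
  coefficient must be 1. The rotated, uncoupled and symmetric states are all instances.\<close>

lemma gp_pair_scaled:
  assumes pair: "gp_pair \<epsilon> \<gamma> e e' (\<lambda>x. 0) (\<lambda>x. 0)"
    and "a = 0 \<or> a\<^sup>2 + \<gamma> * b\<^sup>2 = 1" "b = 0 \<or> b\<^sup>2 + \<gamma> * a\<^sup>2 = 1"
  shows "gp_pair \<epsilon> \<gamma> (\<lambda>x. a * e x) (\<lambda>x. a * e' x) (\<lambda>x. b * e x) (\<lambda>x. b * e' x)"
proof -
  note d = gp_pairD[OF pair]
  have F: "gp_force \<epsilon> \<gamma> (s * u) (t * u) x = s * gp_force \<epsilon> \<gamma> u 0 x"
    if "s = 0 \<or> s\<^sup>2 + \<gamma> * t\<^sup>2 = 1" for s t u x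
  proof -
    have "(s * u)\<^sup>2 + \<gamma> * (t * u)\<^sup>2 = (s\<^sup>2 + \<gamma> * t\<^sup>2) * u\<^sup>2" by (simp add: power_mult_distrib algebra_simps)
    then show ?thesis using that by (auto simp: gp_force_def add.assoc)
  qed
  show ?thesis
    unfolding gp_pair_def F[OF assms(2)] F[OF assms(3)]
    by (intro conjI allI H1_classical_cmult DERIV_cmult d)
qed

lemma L21_cmult: "f \<in> L21 \<Longrightarrow> (\<lambda>x. a * f x) \<in> L21"
  using square_integrable_combination[of f f a 0]
    square_integrable_combination[of "\<lambda>x. \<bar>x\<bar> * f x" "\<lambda>x. \<bar>x\<bar> * f x" a 0]
  by (auto simp: L21_def mult.left_commute)

lemma powr_minus_half: "0 < x \<Longrightarrow> x powr - (1 / 2) = inverse (sqrt x)"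
  using powr_minus[of x "1/2"] by (simp add: powr_half_sqrt)

theorem theorem5:
  "\<exists>\<epsilon>\<^sub>0>0. \<forall>\<epsilon>. 0 < \<epsilon> \<and> \<epsilon> < \<epsilon>\<^sub>0 \<longrightarrow> (\<forall>\<eta>. positive_ground_state \<epsilon> \<eta> \<longrightarrow>
     (\<forall>\<theta>\<in>{0..pi/2}. coupled_solution \<epsilon> 1 (rotated_state \<eta> \<theta>)) \<and>
     continues \<epsilon> (\<lambda>\<gamma>. uncoupled_state1 \<eta>) (rotated_state \<eta> 0) \<and>
     continues \<epsilon> (\<lambda>\<gamma>. uncoupled_state2 \<eta>) (rotated_state \<eta> (pi/2)) \<and>
     continues \<epsilon> (\<lambda>\<gamma>. symmetric_state \<eta> \<gamma>) (rotated_state \<eta> (pi/4)) \<and>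
     (\<exists>\<delta>>0. \<forall>\<gamma> \<Psi> \<theta>.
        \<gamma> > 0 \<and> \<gamma> \<noteq> 1 \<and> \<bar>\<gamma> - 1\<bar> < \<delta> \<and> coupled_solution \<epsilon> \<gamma> \<Psi> \<and>
        \<theta> \<in> {0..pi/2} \<and> energy_dist \<Psi> (rotated_state \<eta> \<theta>) < \<delta> \<longrightarrow>
        \<Psi> = uncoupled_state1 \<eta> \<or> \<Psi> = uncoupled_state2 \<eta> \<or> \<Psi> = symmetric_state \<eta> \<gamma>))"
proof (rule exI[of _ 1], intro conjI allI impI)
  \<comment> \<open>The threshold 1 is a convenient witness: the estimates concern one fixed
    \<open>\<epsilon>\<close>, and \<open>\<delta>\<close> is chosen depending on it and on the
    profile.\<close>
  show "(0::real) < 1" by simp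
next
  fix \<epsilon> \<eta> assume "0 < \<epsilon> \<and> \<epsilon> < 1" and gs: "positive_ground_state \<epsilon> \<eta>"
  then have \<epsilon>: "0 < \<epsilon>" by simp
  note ground = positive_ground_state_gp_pair[OF gs \<epsilon>]
  have \<eta>: "H1_classical \<eta> (deriv \<eta>)" "\<eta> \<in> L21" "\<And>x. 0 < \<eta> x"
    using gp_pairD(1)[OF ground] gs by (auto simp: positive_ground_state_def)
  have scaled: "coupled_solution \<epsilon> \<gamma> ((\<lambda>x. a * \<eta> x), (\<lambda>x. b * \<eta> x))"
    if "a = 0 \<or> a\<^sup>2 + \<gamma> * b\<^sup>2 = 1" "b = 0 \<or> b\<^sup>2 + \<gamma> * a\<^sup>2 = 1" for a b \<gamma>
    by (rule gp_pair_imp_coupled_solution[OF gp_pair_scaled[OF ground that]]) (intro L21_cmult \<eta> \<epsilon>)+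
  \<comment> \<open>For multiples of one profile the distance is the Euclidean distance of the
    coefficients times a fixed number, so continuation reduces to two real limits.\<close>
  have scaled_continues: "continues \<epsilon> (\<lambda>\<gamma>. ((\<lambda>x. a \<gamma> * \<eta> x), (\<lambda>x. b \<gamma> * \<eta> x))) (rotated_state \<eta> \<theta>)"
    if "\<And>\<gamma>. 0 < \<gamma> \<Longrightarrow> a \<gamma> = 0 \<or> (a \<gamma>)\<^sup>2 + \<gamma> * (b \<gamma>)\<^sup>2 = 1"
      "\<And>\<gamma>. 0 < \<gamma> \<Longrightarrow> b \<gamma> = 0 \<or> (b \<gamma>)\<^sup>2 + \<gamma> * (a \<gamma>)\<^sup>2 = 1"
      and lim: "(a \<longlongrightarrow> cos \<theta>) (at 1)" "(b \<longlongrightarrow> sin \<theta>) (at 1)" for a b \<theta>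
  proof -
    let ?N = "sqrt ((LINT x|lborel. (\<eta> x)\<^sup>2) + (LINT x|lborel. (deriv \<eta> x)\<^sup>2) + (LINT x|lborel. (\<bar>x\<bar> * \<eta> x)\<^sup>2))"
    have "energy_dist ((\<lambda>x. a \<gamma> * \<eta> x), (\<lambda>x. b \<gamma> * \<eta> x)) (rotated_state \<eta> \<theta>)
        = sqrt ((a \<gamma> - cos \<theta>)\<^sup>2 + (b \<gamma> - sin \<theta>)\<^sup>2) * ?N" for \<gamma>
      using energy_norm_scaled[OF \<eta>(1), of "a \<gamma> - cos \<theta>" "b \<gamma> - sin \<theta>"]
      by (simp add: energy_dist_def rotated_state_def left_diff_distrib)
    moreover have "((\<lambda>\<gamma>. sqrt ((a \<gamma> - cos \<theta>)\<^sup>2 + (b \<gamma> - sin \<theta>)\<^sup>2) * ?N)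
        \<longlongrightarrow> sqrt ((cos \<theta> - cos \<theta>)\<^sup>2 + (sin \<theta> - sin \<theta>)\<^sup>2) * ?N) (at 1)"
      by (intro tendsto_intros lim)
    ultimately show ?thesis
      using scaled that(1,2) by (simp add: continues_def)
  qed
  show "\<forall>\<theta>\<in>{0..pi/2}. coupled_solution \<epsilon> 1 (rotated_state \<eta> \<theta>)"
    unfolding rotated_state_def by (intro ballI scaled) (simp_all add: add.commute)
  show "continues \<epsilon> (\<lambda>\<gamma>. uncoupled_state1 \<eta>) (rotated_state \<eta> 0)"
    using scaled_continues[of "\<lambda>_. 1" "\<lambda>_. 0" 0] by (simp add: uncoupled_state1_def)
  show "continues \<epsilon> (\<lambda>\<gamma>. uncoupled_state2 \<eta>) (rotated_state \<eta> (pi/2))"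
    using scaled_continues[of "\<lambda>_. 0" "\<lambda>_. 1" "pi/2"] by (simp add: uncoupled_state2_def)
  show "continues \<epsilon> (\<lambda>\<gamma>. symmetric_state \<eta> \<gamma>) (rotated_state \<eta> (pi/4))"
    unfolding symmetric_state_def
  proof (rule scaled_continues)
    show "(1 + \<gamma>) powr (- 1 / 2) = 0 \<or> ((1 + \<gamma>) powr (- 1 / 2))\<^sup>2 + \<gamma> * ((1 + \<gamma>) powr (- 1 / 2))\<^sup>2 = 1"
      if "0 < \<gamma>" for \<gamma> :: real
      using that by (simp add: powr_minus_half power_inverse field_simps)
    then show "(1 + \<gamma>) powr (- 1 / 2) = 0 \<or> ((1 + \<gamma>) powr (- 1 / 2))\<^sup>2 + \<gamma> * ((1 + \<gamma>) powr (- 1 / 2))\<^sup>2 = 1"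
      if "0 < \<gamma>" for \<gamma> :: real
      using that .
    have lim: "((\<lambda>\<gamma>. (1 + \<gamma>) powr (- 1 / 2)) \<longlongrightarrow> (1 + 1) powr (- 1 / 2)) (at (1::real))"
      by (intro tendsto_intros) auto
    have "(1 + 1) powr (- 1 / 2) = sqrt 2 / (2::real)"
      by (simp add: powr_minus_half field_simps)
    from lim[unfolded this] show "((\<lambda>\<gamma>. (1 + \<gamma>) powr (- 1 / 2)) \<longlongrightarrow> cos (pi/4)) (at 1)"
      "((\<lambda>\<gamma>. (1 + \<gamma>) powr (- 1 / 2)) \<longlongrightarrow> sin (pi/4)) (at 1)"
      unfolding cos_45 sin_45 by assumption+
  qed
  have "continuous_on {-2..2} \<eta>"
    using gp_pairD(3)[OF ground] by (blast intro: DERIV_atLeastAtMost_imp_continuous_on)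
  moreover have "compact {-2..2::real}" "{-2..2::real} \<noteq> {}" by auto
  ultimately obtain x\<^sub>0 where "\<forall>x\<in>{-2..2}. \<eta> x\<^sub>0 \<le> \<eta> x"
    using continuous_attains_inf[of "{-2..2}" \<eta>] by blast
  then obtain m where m: "0 < m" "\<And>x. x \<in> {-2..2} \<Longrightarrow> m \<le> \<eta> x" using \<eta>(3) by blast
  obtain B where B: "\<And>x. \<eta> x \<le> B"
    using sup_le_energy_norm(1)[OF \<eta>(1) H1_classical_zero] by (meson abs_ge_self order_trans)
  have "0 < B" using B[of 0] \<eta>(3)[of 0] by simp
  \<comment> \<open>The bound must also cover the rotated component \<open>a * (f + g)\<close> with
    \<open>a \<le> 1\<close>, where \<open>f\<close> and \<open>g\<close> are at most
    \<open>B + 1\<close>.\<close>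
  define K where "K = 2 * B + 2"
  define D where "D = contraction_bound \<epsilon> (m / 8) K"
  have D: "0 \<le> D"
    using \<open>0 < B\<close> by (auto simp: D_def contraction_bound_def K_def intro!: add_nonneg_nonneg divide_nonneg_nonneg mult_nonneg_nonneg)
  \<comment> \<open>The bound 1 keeps \<open>\<gamma>\<close> below 3 and the components below
    \<open>B + 1\<close>; \<open>m / 16\<close> preserves a gap of \<open>m / 8\<close> on the core;
    the last term yields the contraction, with \<open>D + 1\<close> avoiding division by
    zero.\<close>
  define \<delta> where "\<delta> = min 1 (min (m / 16) (\<epsilon>\<^sup>2 / (8 * (D + 1))))"
  have \<delta>: "0 < \<delta>" "\<delta> \<le> 1" "\<delta> \<le> m / 16" "8 * \<delta> * D \<le> \<epsilon>\<^sup>2"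
  proof -
    show "0 < \<delta>" using m(1) \<epsilon> D by (simp add: \<delta>_def)
    show "\<delta> \<le> 1" unfolding \<delta>_def by (rule min.cobounded1)
    show "\<delta> \<le> m / 16" unfolding \<delta>_def by (intro min.coboundedI2 min.cobounded1)
    have "\<delta> \<le> \<epsilon>\<^sup>2 / (8 * (D + 1))"
      unfolding \<delta>_def by (intro min.coboundedI2 min.cobounded2)
    then have "\<delta> * (8 * (D + 1)) \<le> \<epsilon>\<^sup>2" using D by (simp add: le_divide_eq)
    then show "8 * \<delta> * D \<le> \<epsilon>\<^sup>2" using \<open>0 < \<delta>\<close> by (simp add: algebra_simps)
  qed
  \<comment> \<open>The tolerance is \<open>2 * \<delta>\<close> because the rotated system has a
    coupling up to twice as far from 1.\<close>
  have uncoupled: "g = (\<lambda>x. 0) \<and> f = \<eta>"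
    if "gp_pair \<epsilon> \<gamma> f f' g g'" "0 < \<gamma>" "\<gamma> < 3" "\<gamma> \<noteq> 1" "\<bar>\<gamma> - 1\<bar> \<le> 2 * \<delta>"
      "\<And>x. x \<in> {-2..2} \<Longrightarrow> m / 8 + \<bar>g x\<bar> \<le> f x" "\<And>x. f x \<le> K" for f f' g g' \<gamma>
  proof -
    have "4 * \<bar>\<gamma> - 1\<bar> * D \<le> 4 * (2 * \<delta>) * D" using that(5) D by (intro mult_right_mono) auto
    then have "4 * \<bar>\<gamma> - 1\<bar> * contraction_bound \<epsilon> (m / 8) K \<le> \<epsilon>\<^sup>2" using \<delta>(4) by (simp add: D_def)
    then show ?thesis
      using dominated_pair_is_uncoupled[OF that(1) \<epsilon> that(2-4) _ that(6,7) _ ground \<eta>(3)] m(1) by auto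
  qed
  show "\<exists>\<delta>>0. \<forall>\<gamma> \<Psi> \<theta>.
        \<gamma> > 0 \<and> \<gamma> \<noteq> 1 \<and> \<bar>\<gamma> - 1\<bar> < \<delta> \<and> coupled_solution \<epsilon> \<gamma> \<Psi> \<and>
        \<theta> \<in> {0..pi/2} \<and> energy_dist \<Psi> (rotated_state \<eta> \<theta>) < \<delta> \<longrightarrow>
        \<Psi> = uncoupled_state1 \<eta> \<or> \<Psi> = uncoupled_state2 \<eta> \<or> \<Psi> = symmetric_state \<eta> \<gamma>"
  proof (intro exI[of _ \<delta>] conjI allI impI)
    show "0 < \<delta>" by (rule \<delta>)
    fix \<gamma> \<Psi> \<theta>
    assume *: "\<gamma> > 0 \<and> \<gamma> \<noteq> 1 \<and> \<bar>\<gamma> - 1\<bar> < \<delta> \<and> coupled_solution \<epsilon> \<gamma> \<Psi> \<and>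
        \<theta> \<in> {0..pi/2} \<and> energy_dist \<Psi> (rotated_state \<eta> \<theta>) < \<delta>"
    obtain f g where \<Psi>: "\<Psi> = (f, g)" by (cases \<Psi>)
    have \<gamma>: "0 < \<gamma>" "\<gamma> < 3" "\<gamma> \<noteq> 1" "\<bar>\<gamma> - 1\<bar> < \<delta>" using * \<delta>(2) by auto
    have pair: "gp_pair \<epsilon> \<gamma> f (deriv f) g (deriv g)"
      using * \<epsilon> by (intro coupled_solution_imp_gp_pair) (auto simp: \<Psi>)
    have trig: "0 \<le> cos \<theta>" "0 \<le> sin \<theta>" "cos \<theta> \<le> 1" "sin \<theta> \<le> 1"
      using * by (auto intro!: cos_ge_zero sin_ge_zero)
    \<comment> \<open>Closeness in energy gives uniform closeness, by the Sobolev bound applied to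
      the differences.\<close>
    have near: "\<bar>f x - cos \<theta> * \<eta> x\<bar> < \<delta>" "\<bar>g x - sin \<theta> * \<eta> x\<bar> < \<delta>" for x
    proof -
      have "H1_classical (\<lambda>x. 1 * f x + - cos \<theta> * \<eta> x) (\<lambda>x. 1 * deriv f x + - cos \<theta> * deriv \<eta> x)"
        "H1_classical (\<lambda>x. 1 * g x + - sin \<theta> * \<eta> x) (\<lambda>x. 1 * deriv g x + - sin \<theta> * deriv \<eta> x)"
        by (intro H1_classical_combination gp_pairD[OF pair] \<eta>)+
      from sup_le_energy_norm[OF this, of x]
      show "\<bar>f x - cos \<theta> * \<eta> x\<bar> < \<delta>" "\<bar>g x - sin \<theta> * \<eta> x\<bar> < \<delta>"
        using * by (simp_all add: \<Psi> energy_dist_def rotated_state_def)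
    qed
    have upper: "f x \<le> B + 1" "g x \<le> B + 1" for x
    proof -
      have "cos \<theta> * \<eta> x \<le> 1 * B" "sin \<theta> * \<eta> x \<le> 1 * B"
        using trig B[of x] \<eta>(3)[of x] by (intro mult_mono; simp)+
      then show "f x \<le> B + 1" "g x \<le> B + 1" using near[of x] \<delta>(2) by linarith+
    qed
    have upper_K: "f x \<le> K" "g x \<le> K" for x using upper[of x] \<open>0 < B\<close> by (simp_all add: K_def)
    \<comment> \<open>In the first two cases the components of the rotated state differ by at least
      \<open>m / 4\<close> on the core, and the perturbation costs at most
      \<open>2 * \<delta> \<le> m / 8\<close>. In the third case neither component is small
      there.\<close>
    consider "1 / 4 \<le> cos \<theta> - sin \<theta>" | "1 / 4 \<le> sin \<theta> - cos \<theta>" | "\<bar>cos \<theta> - sin \<theta>\<bar> \<le> 1 / 4"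
      by linarith
    then show "\<Psi> = uncoupled_state1 \<eta> \<or> \<Psi> = uncoupled_state2 \<eta> \<or> \<Psi> = symmetric_state \<eta> \<gamma>"
    proof cases
      case 1
      have "m / 8 + \<bar>g x\<bar> \<le> f x" if "x \<in> {-2..2}" for x
      proof -
        have "1 / 4 * m \<le> (cos \<theta> - sin \<theta>) * \<eta> x" using 1 m that by (intro mult_mono) auto
        moreover have "0 \<le> sin \<theta> * \<eta> x" using trig \<eta>(3)[of x] by simp
        ultimately show ?thesis using near[of x] \<delta>(3) by (simp add: left_diff_distrib abs_less_iff abs_le_iff) linarith
      qed
      then have "g = (\<lambda>x. 0) \<and> f = \<eta>"
        using upper_K \<gamma> \<delta>(1) by (intro uncoupled[OF pair]) auto
      then show ?thesis by (simp add: \<Psi> uncoupled_state1_def)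
    next
      case 2
      have "m / 8 + \<bar>f x\<bar> \<le> g x" if "x \<in> {-2..2}" for x
      proof -
        have "1 / 4 * m \<le> (sin \<theta> - cos \<theta>) * \<eta> x" using 2 m that by (intro mult_mono) auto
        moreover have "0 \<le> cos \<theta> * \<eta> x" using trig \<eta>(3)[of x] by simp
        ultimately show ?thesis using near[of x] \<delta>(3) by (simp add: left_diff_distrib abs_less_iff abs_le_iff) linarith
      qed
      then have "f = (\<lambda>x. 0) \<and> g = \<eta>"
        using upper_K \<gamma> \<delta>(1) by (intro uncoupled[OF gp_pair_swap[OF pair]]) auto
      then show ?thesis by (simp add: \<Psi> uncoupled_state2_def)
    next
      case 3
      define a where "a = sqrt (1 + \<gamma>) / 2"
      have a: "1 / 2 \<le> a" "a \<le> 1" using \<gamma> by (auto simp: a_def intro!: real_le_lsqrt)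
      \<comment> \<open>The squared difference is
        \<open>1 - 2 * cos \<theta> * sin \<theta>\<close>, so the product is at least 15/32; as
        both factors are at most 1, each is at least that large.\<close>
      have cs: "1 / 4 \<le> cos \<theta>" "1 / 4 \<le> sin \<theta>"
      proof -
        have "(cos \<theta> - sin \<theta>)\<^sup>2 \<le> (1 / 4)\<^sup>2" using 3 by (simp add: abs_le_square_iff[symmetric])
        then have "15 / 32 \<le> cos \<theta> * sin \<theta>"
          using sin_cos_squared_add[of \<theta>] by (simp add: power2_diff power_divide)
        moreover have "cos \<theta> * sin \<theta> \<le> cos \<theta> * 1" "cos \<theta> * sin \<theta> \<le> 1 * sin \<theta>"
          using trig by (intro mult_left_mono mult_right_mono; simp)+
        ultimately show "1 / 4 \<le> cos \<theta>" "1 / 4 \<le> sin \<theta>" by linarith+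
      qed
      have low: "m / 8 \<le> f x" "m / 8 \<le> g x" if "x \<in> {-2..2}" for x
      proof -
        have "1 / 4 * m \<le> cos \<theta> * \<eta> x" "1 / 4 * m \<le> sin \<theta> * \<eta> x"
          using cs m that by (intro mult_mono; simp)+
        then show "m / 8 \<le> f x" "m / 8 \<le> g x" using near[of x] \<delta>(3) m(1) by linarith+
      qed
      have "(\<lambda>x. a * f x + (- a) * g x) = (\<lambda>x. 0) \<and> (\<lambda>x. a * f x + a * g x) = \<eta>"
      proof (rule uncoupled[OF gp_pair_rotate[OF pair \<gamma>(1) a_def]])
        \<comment> \<open>The map from \<open>\<gamma>\<close> to the new coupling fixes 1 and at
          most doubles the distance to it, as the denominator exceeds 1.\<close>
        have "(3 - \<gamma>) / (1 + \<gamma>) - 1 = 2 * (1 - \<gamma>) / (1 + \<gamma>)" using \<gamma> by (simp add: field_simps)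
        then have "\<bar>(3 - \<gamma>) / (1 + \<gamma>) - 1\<bar> = 2 * \<bar>\<gamma> - 1\<bar> / (1 + \<gamma>)"
          using \<gamma>(1) by (simp only: abs_divide) (simp add: abs_if)
        also have "\<dots> \<le> 2 * \<bar>\<gamma> - 1\<bar> / 1" using \<gamma>(1) by (intro divide_left_mono) auto
        finally show "\<bar>(3 - \<gamma>) / (1 + \<gamma>) - 1\<bar> \<le> 2 * \<delta>" using \<gamma>(4) by simp
        show "0 < (3 - \<gamma>) / (1 + \<gamma>)" "(3 - \<gamma>) / (1 + \<gamma>) < 3" "(3 - \<gamma>) / (1 + \<gamma>) \<noteq> 1"
          using \<gamma> by (auto simp: field_simps)
        show "m / 8 + \<bar>a * f x + (- a) * g x\<bar> \<le> a * f x + a * g x" if "x \<in> {-2..2}" for x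
        proof -
          \<comment> \<open>The gap between the sum and the absolute difference is twice the smaller
            of \<open>a * f x\<close> and \<open>a * g x\<close>.\<close>
          have "1 / 2 * (m / 8) \<le> a * f x" "1 / 2 * (m / 8) \<le> a * g x"
            using a low[OF that] m(1) by (intro mult_mono; simp)+
          then show ?thesis by (simp add: abs_le_iff)
        qed
        show "a * f x + a * g x \<le> K" for x
        proof -
          have "a * f x \<le> a * (B + 1)" "a * g x \<le> a * (B + 1)"
            using a upper[of x] by (intro mult_left_mono; simp)+
          moreover have "a * (B + 1) \<le> 1 * (B + 1)" using a \<open>0 < B\<close> by (intro mult_right_mono) auto
          ultimately show ?thesis by (simp add: K_def)
        qed
      qed
      then have "a * (f x - g x) = 0" "a * (f x + g x) = \<eta> x" for x
        by (auto simp: fun_eq_iff algebra_simps)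
      then have "f x = g x" "2 * a * f x = \<eta> x" for x
        using a(1) by (auto simp: algebra_simps)
      then have "f x = (1 + \<gamma>) powr (- 1 / 2) * \<eta> x" "g x = (1 + \<gamma>) powr (- 1 / 2) * \<eta> x" for x
        using \<gamma>(1) by (simp_all add: powr_minus_half a_def field_simps)
      then show ?thesis by (simp add: \<Psi> symmetric_state_def fun_eq_iff)
    qed
  qed
qed

end
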